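(* Let $k\ge 3$ be an integer and let $r>0$ be a real number. Then for every $\varepsilon>0$, as $x\to\infty$, $$\sum_{n_1,\ldots,n_k\le x}\left(\frac{[n_1,\ldots,n_k]}{(n_1,\ldots,n_k)}\right)^r=D_{r,k}\,\frac{x^{k(r+1)}}{(r+1)^k}+O\left(x^{k(r+1)-\frac12+\varepsilon}\right),$$ where $$D_{r,k}=\prod_p\left(1-\frac1p\right)^k\sum_{\nu_1,\ldots,\nu_k=0}^{\infty}\frac{p^{r(\max(\nu_1,\ldots,\nu_k)-\min(\nu_1,\ldots,\nu_k))}}{p^{(r+1)(\nu_1+\cdots+\nu_k)}}.$$ In particular, $$D_{r,3}=C_{r,3}\,\frac{\zeta(3r+3)}{\zeta(2r+3)},\qquad D_{r,4}=C_{r,4}\,\frac{\zeta(4r+4)}{\zeta(3r+4)},$$ where $$C_{r,k}=\prod_p\left(1-\frac1p\right)^k\sum_{\nu_1,\ldots,\nu_k=0}^{\infty}\frac{p^{r\max(\nu_1,\ldots,\nu_k)}}{p^{(r+1)(\nu_1+\cdots+\nu_k)}}.$$ All products are over all primes $p$.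
   Context: $[n_1,\ldots,n_k]$ and $(n_1,\ldots,n_k)$ denote the least common multiple and the greatest common divisor of the positive integers $n_1,\ldots,n_k$; sums over $n_1,\ldots,n_k\le x$ run over all $k$-tuples of positive integers each at most $x$. $\zeta$ is the Riemann zeta function. Implied constants may depend on $k$, $r$, $\varepsilon$. *)

theory Defs
  imports
    "HOL-Analysis.Analysis"
    "HOL-Computational_Algebra.Primes"
    "HOL-Library.Landau_Symbols"
begin

definition tuples :: "nat \<Rightarrow> nat set \<Rightarrow> (nat \<Rightarrow> nat) set" where
  "tuples k A = PiE {..<k} (\<lambda>_. A)"

definition tuple_max :: "nat \<Rightarrow> (nat \<Rightarrow> nat) \<Rightarrow> nat" where
  "tuple_max k \<nu> = Max (\<nu> ` {..<k})"

definition tuple_min :: "nat \<Rightarrow> (nat \<Rightarrow> nat) \<Rightarrow> nat" where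
  "tuple_min k \<nu> = Min (\<nu> ` {..<k})"

definition lcm_gcd_sum :: "real \<Rightarrow> nat \<Rightarrow> real \<Rightarrow> real" where
  "lcm_gcd_sum r k x =
     (\<Sum>n\<in>tuples k {m. 0 < m \<and> real m \<le> x}.
        (real (Lcm (n ` {..<k})) / real (Gcd (n ` {..<k}))) powr r)"

definition C_term :: "real \<Rightarrow> nat \<Rightarrow> nat \<Rightarrow> (nat \<Rightarrow> nat) \<Rightarrow> real" where
  "C_term r k p \<nu> =
     real p powr (r * real (tuple_max k \<nu>)) / real p powr ((r + 1) * real (\<Sum>i<k. \<nu> i))"

definition D_term :: "real \<Rightarrow> nat \<Rightarrow> nat \<Rightarrow> (nat \<Rightarrow> nat) \<Rightarrow> real" where
  "D_term r k p \<nu> =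
     real p powr (r * (real (tuple_max k \<nu>) - real (tuple_min k \<nu>)))
       / real p powr ((r + 1) * real (\<Sum>i<k. \<nu> i))"

text \<open>
  An Euler product with local factors \<open>(1 - 1/p)\<^sup>k \<Sum>\<^sub>\<nu> t p \<nu>\<close> is an infinite product over all
  natural numbers, in increasing order, in which the non-primes contribute the factor 1.
\<close>

definition euler_factor :: "nat \<Rightarrow> (nat \<Rightarrow> (nat \<Rightarrow> nat) \<Rightarrow> real) \<Rightarrow> nat \<Rightarrow> real" where
  "euler_factor k t p =
     (if prime p then (1 - 1 / real p) ^ k * (\<Sum>\<^sub>\<infinity>\<nu>\<in>tuples k UNIV. t p \<nu>) else 1)"

text \<open>
  \<open>infsum\<close> and \<open>prodinf\<close> are total functions with junk values in the divergent case.  The following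
  predicate says that all the local series and the product over the primes really converge.
\<close>

definition euler_converges :: "nat \<Rightarrow> (nat \<Rightarrow> (nat \<Rightarrow> nat) \<Rightarrow> real) \<Rightarrow> bool" where
  "euler_converges k t \<longleftrightarrow>
     (\<forall>p. prime p \<longrightarrow> t p summable_on tuples k UNIV) \<and> convergent_prod (euler_factor k t)"

definition C_const :: "real \<Rightarrow> nat \<Rightarrow> real" where
  "C_const r k = prodinf (euler_factor k (C_term r k))"

definition D_const :: "real \<Rightarrow> nat \<Rightarrow> real" where
  "D_const r k = prodinf (euler_factor k (D_term r k))"

text \<open>The Riemann zeta function on the half-line \<open>s > 1\<close>, where its Dirichlet series converges.\<close>

definition zeta :: "real \<Rightarrow> real" where
  "zeta s = (\<Sum>n. 1 / real (Suc n) powr s)"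

end

theory Submission
  imports Defs
begin

text \<open>
  Divide the summand by \<open>(n\<^sub>1 \<cdots> n\<^sub>k)\<^sup>r\<close>. The quotient \<open>g\<close> is multiplicative in the tuple, lies in
  \<open>[0, 1]\<close> at every prime and equals \<open>1\<close> at a tuple that is \<open>1\<close> except for one prime entry. Writing
  \<open>g(n)\<close> as the sum of \<open>h(d)\<close> over the tuples \<open>d\<close> with \<open>d\<^sub>i\<close> dividing \<open>n\<^sub>i\<close>, the function \<open>h\<close> is
  bounded by \<open>2\<^sup>k\<close> at every prime and its local terms of degree \<open>1\<close> vanish, so the series of
  \<open>\<bar>h(d)\<bar> (d\<^sub>1 \<cdots> d\<^sub>k)\<^bsup>-\<sigma>\<^esup>\<close> converges for \<open>\<sigma> > 1/2\<close>; at \<open>\<sigma> = 1\<close> the series of \<open>h\<close> has the sum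
  \<open>D\<^bsub>r,k\<^esub>\<close>. The theorem follows by inserting
  \<open>\<Sum>\<^bsub>m \<le> y\<^esub> m\<^sup>r = y\<^bsup>r+1\<^esup> / (r + 1) + O(y\<^bsup>r+1-\<delta>\<^esup>)\<close> at \<open>y = x / d\<^sub>i\<close>, uniformly in \<open>y > 0\<close>, for
  \<open>\<delta> < 1/2\<close>.
\<close>

subsection \<open>Sums over tuples\<close>

lemma has_sum_sum:
  fixes f :: "'i \<Rightarrow> 'a \<Rightarrow> 'b :: topological_comm_monoid_add"
  assumes "finite I" "\<And>i. i \<in> I \<Longrightarrow> (f i has_sum s i) A"
  shows "((\<lambda>x. \<Sum>i\<in>I. f i x) has_sum (\<Sum>i\<in>I. s i)) A"
  using assms by (induction I rule: finite_induct) (auto intro!: has_sum_add)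

text \<open>Any finite set of choice functions lies in a finite box, over which the sum of the
  absolute products factors. The product of the full absolute sums therefore bounds all finite
  partial sums.\<close>

lemma summable_prod_PiE_real:
  fixes f :: "'a \<Rightarrow> 'b \<Rightarrow> real"
  assumes "finite A" and f: "\<And>x. x \<in> A \<Longrightarrow> f x summable_on B x"
  shows "(\<lambda>g. \<Prod>x\<in>A. f x (g x)) summable_on PiE A B"
proof -
  define h where "h = (\<lambda>x y. \<bar>f x y\<bar>)"
  have h: "h x summable_on B x" if "x \<in> A" for x
    using f[OF that] summable_on_iff_abs_summable_on_real[of "f x" "B x"] by (simp add: h_def)
  have "(\<lambda>g. \<Prod>x\<in>A. h x (g x)) summable_on PiE A B"
  proof (rule nonneg_bdd_above_summable_on)
    show "0 \<le> (\<Prod>x\<in>A. h x (g x))" for g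
      by (intro prod_nonneg) (auto simp: h_def)
    show "bdd_above (sum (\<lambda>g. \<Prod>x\<in>A. h x (g x)) ` {F. F \<subseteq> PiE A B \<and> finite F})"
    proof (intro bdd_aboveI2)
      fix F assume "F \<in> {F. F \<subseteq> PiE A B \<and> finite F}"
      hence F: "F \<subseteq> PiE A B" "finite F" by auto
      let ?Q = "\<lambda>x. (\<lambda>g. g x) ` F"
      have "(\<Sum>g\<in>F. \<Prod>x\<in>A. h x (g x)) \<le> (\<Sum>g\<in>PiE A ?Q. \<Prod>x\<in>A. h x (g x))"
        using F \<open>finite A\<close>
        by (intro sum_mono2 finite_PiE prod_nonneg) (auto simp: h_def PiE_def Pi_def extensional_def)
      also have "\<dots> = (\<Prod>x\<in>A. \<Sum>y\<in>?Q x. h x y)"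
        using F \<open>finite A\<close> by (intro prod_sum_PiE [symmetric]) auto
      also have "\<dots> \<le> (\<Prod>x\<in>A. infsum (h x) (B x))"
        using F by (intro prod_mono conjI sum_nonneg finite_sum_le_infsum h) (auto simp: h_def)
      finally show "(\<Sum>g\<in>F. \<Prod>x\<in>A. h x (g x)) \<le> (\<Prod>x\<in>A. infsum (h x) (B x))" .
    qed
  qed
  thus ?thesis
    by (subst summable_on_iff_abs_summable_on_real) (simp add: h_def abs_prod)
qed

lemma infsum_prod_PiE_real:
  fixes f :: "'a \<Rightarrow> 'b \<Rightarrow> real"
  assumes "finite A" and "\<And>x. x \<in> A \<Longrightarrow> f x summable_on B x"
  shows "infsum (\<lambda>g. \<Prod>x\<in>A. f x (g x)) (PiE A B) = (\<Prod>x\<in>A. infsum (f x) (B x))"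
  using assms summable_prod_PiE_real[OF assms] by (intro infsum_prod_PiE) auto

lemma
  fixes q :: real
  assumes "0 \<le> q" "q < 1"
  shows summable_on_geometric_tuples: "(\<lambda>\<nu>. q ^ (\<Sum>i<k. \<nu> i)) summable_on tuples k UNIV"
    and infsum_geometric_tuples: "(\<Sum>\<^sub>\<infinity>\<nu>\<in>tuples k UNIV. q ^ (\<Sum>i<k. \<nu> i)) = (1 / (1 - q)) ^ k"
proof -
  have s: "((^) q has_sum (1 / (1 - q))) UNIV"
    using assms by (intro sums_nonneg_imp_has_sum geometric_sums) auto
  show "(\<lambda>\<nu>. q ^ (\<Sum>i<k. \<nu> i)) summable_on tuples k UNIV"
    unfolding power_sum tuples_def
    by (intro summable_prod_PiE_real) (use s in \<open>auto simp: has_sum_iff\<close>)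
  show "(\<Sum>\<^sub>\<infinity>\<nu>\<in>tuples k UNIV. q ^ (\<Sum>i<k. \<nu> i)) = (1 / (1 - q)) ^ k"
    unfolding power_sum tuples_def
    by (subst infsum_prod_PiE_real) (use s in \<open>auto simp: has_sum_iff\<close>)
qed

text \<open>Only j of the m factors keep their decay in \<open>q\<close>; the others are replaced by
  a fixed ratio \<open>q0\<close>. Summed over all degrees at least j, this leaves
  \<open>q ^ j\<close> times a constant that will be the same for all primes.\<close>

lemma power_le_geometric_majorant:
  fixes q q0 :: real
  assumes "0 \<le> q" "q \<le> q0" "0 < q0" "j \<le> m"
  shows "q ^ m \<le> (q / q0) ^ j * q0 ^ m"
proof -
  have "q ^ m = q ^ j * q ^ (m - j)"
    using assms by (simp flip: power_add)
  also have "\<dots> \<le> q ^ j * q0 ^ (m - j)"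
    using assms by (intro mult_left_mono power_mono) auto
  also have "\<dots> = (q / q0) ^ j * q0 ^ m"
    using assms by (simp add: power_diff power_divide)
  finally show ?thesis .
qed

subsection \<open>Mixed differences\<close>

text \<open>The product over all coordinates of the backward difference operators, with
  \<open>g\<close> read as 0 wherever a coordinate would become negative. This is the local form of
  Moebius inversion over divisor tuples. The \<open>if\<close> supplies the value 0, since natural
  subtraction would truncate instead.\<close>

definition mixed_diff :: "nat \<Rightarrow> ((nat \<Rightarrow> nat) \<Rightarrow> real) \<Rightarrow> (nat \<Rightarrow> nat) \<Rightarrow> real" where
  "mixed_diff k g \<nu> =
     (\<Sum>S\<in>Pow {..<k}. (-1) ^ card S *
        (if \<forall>i\<in>S. 0 < \<nu> i then g (\<lambda>i\<in>{..<k}. \<nu> i - of_bool (i \<in> S)) else 0))"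

lemma abs_mixed_diff_le:
  assumes "\<And>\<mu>. \<bar>g \<mu>\<bar> \<le> 1"
  shows "\<bar>mixed_diff k g \<nu>\<bar> \<le> 2 ^ k"
proof -
  have "\<bar>mixed_diff k g \<nu>\<bar> \<le> (\<Sum>S\<in>Pow {..<k}. 1)"
    unfolding mixed_diff_def
    by (rule order.trans[OF sum_abs], rule sum_mono) (auto simp: abs_mult power_abs assms)
  thus ?thesis by (simp add: card_Pow)
qed

lemma mixed_diff_zero:
  assumes "\<And>i. i < k \<Longrightarrow> \<nu> i = 0" "\<nu> \<in> tuples k UNIV"
  shows "mixed_diff k g \<nu> = g \<nu>"
proof -
  have "mixed_diff k g \<nu> = (\<Sum>S\<in>{{}}. (-1) ^ card S *
        (if \<forall>i\<in>S. 0 < \<nu> i then g (\<lambda>i\<in>{..<k}. \<nu> i - of_bool (i \<in> S)) else 0))"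
    unfolding mixed_diff_def
  proof (intro sum.mono_neutral_right ballI)
    fix S assume "S \<in> Pow {..<k} - {{}}"
    then obtain i where "i \<in> S" "i < k" by auto
    hence "\<nu> i = 0" using assms(1) by simp
    with \<open>i \<in> S\<close> have "\<not> (\<forall>i\<in>S. 0 < \<nu> i)" by (metis less_irrefl)
    thus "(-1) ^ card S *
        (if \<forall>i\<in>S. 0 < \<nu> i then g (\<lambda>i\<in>{..<k}. \<nu> i - of_bool (i \<in> S)) else 0) = 0"
      by (subst if_not_P) auto
  qed auto
  also have "\<dots> = g (\<lambda>i\<in>{..<k}. \<nu> i)" by simp
  also have "(\<lambda>i\<in>{..<k}. \<nu> i) = \<nu>"
    using assms(2) by (auto simp: tuples_def)
  finally show ?thesis .
qed

text \<open>A set S contributes only if \<nu> is positive on all of S, which leaves the empty set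
  and the singleton of j.\<close>

lemma mixed_diff_unit:
  assumes "j < k" "\<nu> = (\<lambda>i\<in>{..<k}. of_bool (i = j))"
  shows "mixed_diff k g \<nu> = g \<nu> - g (\<lambda>i\<in>{..<k}. 0)"
proof -
  have "mixed_diff k g \<nu> = (\<Sum>S\<in>{{}, {j}}. (-1) ^ card S *
        (if \<forall>i\<in>S. 0 < \<nu> i then g (\<lambda>i\<in>{..<k}. \<nu> i - of_bool (i \<in> S)) else 0))"
    unfolding mixed_diff_def using assms
    by (intro sum.mono_neutral_right) (auto simp: subset_iff)
  also have "\<dots> = g (\<lambda>i\<in>{..<k}. \<nu> i) - g (\<lambda>i\<in>{..<k}. \<nu> i - of_bool (i = j))"
    using assms by simp
  also have "(\<lambda>i\<in>{..<k}. \<nu> i) = \<nu>"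
    using assms by auto
  also have "(\<lambda>i\<in>{..<k}. \<nu> i - of_bool (i = j)) = (\<lambda>i\<in>{..<k}. 0)"
    using assms by auto
  finally show ?thesis .
qed

text \<open>Summation by parts in every coordinate.\<close>

lemma infsum_mixed_diff:
  fixes w :: "nat \<Rightarrow> nat \<Rightarrow> real"
  assumes g: "\<And>\<mu>. \<bar>g \<mu>\<bar> \<le> 1" and w: "\<And>i. w i summable_on UNIV"
  shows "(\<Sum>\<^sub>\<infinity>\<nu>\<in>tuples k UNIV. mixed_diff k g \<nu> * (\<Prod>i<k. w i (\<nu> i)))
       = (\<Sum>\<^sub>\<infinity>\<mu>\<in>tuples k UNIV. g \<mu> * (\<Prod>i<k. w i (\<mu> i) - w i (Suc (\<mu> i))))"
proof -
  \<comment> \<open>\<open>sh S\<close> raises the coordinates in S by one. \<open>t S\<close> is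
    the S-term of the left-hand series, and \<open>u S\<close> is the same term after the
    substitution \<nu> = \<open>sh S \<mu>\<close>, which makes every term evaluate \<open>g\<close>
    at \<mu>.\<close>
  define sh where "sh = (\<lambda>S \<mu>. \<lambda>i\<in>{..<k}. \<mu> i + of_bool (i \<in> S) :: nat)"
  define t where "t = (\<lambda>S \<nu>. (-1) ^ card S *
    (if \<forall>i\<in>S. 0 < \<nu> i then g (\<lambda>i\<in>{..<k}. \<nu> i - of_bool (i \<in> S)) else 0) * (\<Prod>i<k. w i (\<nu> i)))"
  define u where "u = (\<lambda>S \<mu>. (-1) ^ card S * (g \<mu> * (\<Prod>i<k. w i (\<mu> i + of_bool (i \<in> S)))))"
  have w': "(\<lambda>m. w i (m + of_bool b)) summable_on UNIV" for i and b
  proof (cases b)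
    case True
    have "w i summable_on range Suc"
      by (rule summable_on_subset_banach[OF w]) auto
    hence "(\<lambda>m. w i (Suc m)) summable_on UNIV"
      by (subst (asm) summable_on_reindex) (auto simp: o_def)
    thus ?thesis using True by simp
  qed (use w in auto)
  have u: "u S summable_on tuples k UNIV" for S
  proof -
    have "(\<lambda>\<mu>. \<Prod>i<k. w i (\<mu> i + of_bool (i \<in> S))) summable_on tuples k UNIV"
      unfolding tuples_def by (intro summable_prod_PiE_real) (use w' in auto)
    hence "(\<lambda>\<mu>. norm (\<Prod>i<k. w i (\<mu> i + of_bool (i \<in> S)))) summable_on tuples k UNIV"
      by (rule summable_on_iff_abs_summable_on_real[THEN iffD1])
    hence "(\<lambda>\<mu>. norm (u S \<mu>)) summable_on tuples k UNIV"
      by (rule Infinite_Sum.abs_summable_on_comparison_test)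
         (auto simp: u_def abs_mult power_abs intro!: mult_left_le_one_le g)
    thus ?thesis by (rule abs_summable_summable)
  qed
  have bij: "bij_betw (sh S) (tuples k UNIV) {\<nu>\<in>tuples k UNIV. \<forall>i\<in>S. 0 < \<nu> i}"
    if "S \<subseteq> {..<k}" for S
  proof (intro bij_betw_byWitness[where f' = "\<lambda>\<nu>. \<lambda>i\<in>{..<k}. \<nu> i - of_bool (i \<in> S)"] ballI)
    fix \<nu> assume \<nu>: "\<nu> \<in> {\<nu>\<in>tuples k UNIV. \<forall>i\<in>S. 0 < \<nu> i}"
    have "\<nu> i - of_bool (i \<in> S) + of_bool (i \<in> S) = \<nu> i" for i
      using \<nu> by (auto simp: of_bool_def)
    thus "sh S (\<lambda>i\<in>{..<k}. \<nu> i - of_bool (i \<in> S)) = \<nu>"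
      using \<nu> by (auto simp: sh_def tuples_def fun_eq_iff PiE_iff extensional_def)
  qed (use that in \<open>auto simp: sh_def tuples_def fun_eq_iff PiE_iff extensional_def split: if_splits\<close>)
  have tu: "t S (sh S \<mu>) = u S \<mu>" if "S \<subseteq> {..<k}" "\<mu> \<in> tuples k UNIV" for S \<mu>
  proof -
    have "(\<lambda>i\<in>{..<k}. sh S \<mu> i - of_bool (i \<in> S)) = \<mu>"
      using that by (auto simp: sh_def tuples_def fun_eq_iff PiE_iff extensional_def)
    moreover have "\<forall>i\<in>S. 0 < sh S \<mu> i"
      using that by (auto simp: sh_def)
    ultimately show ?thesis by (simp add: t_def u_def sh_def)
  qed
  have t: "(t S has_sum infsum (u S) (tuples k UNIV)) (tuples k UNIV)" if S: "S \<subseteq> {..<k}" for S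
  proof -
    have "((\<lambda>\<mu>. t S (sh S \<mu>)) has_sum infsum (u S) (tuples k UNIV)) (tuples k UNIV)"
      using u[of S] by (subst has_sum_cong[OF tu[OF S]]) (auto simp: has_sum_iff)
    hence "(t S has_sum infsum (u S) (tuples k UNIV)) {\<nu>\<in>tuples k UNIV. \<forall>i\<in>S. 0 < \<nu> i}"
      using has_sum_reindex_bij_betw[OF bij[OF S]] by blast
    \<comment> \<open>Tuples outside the image of \<open>sh S\<close> contribute nothing, by the
      value 0 built into \<open>mixed_diff\<close>.\<close>
    thus ?thesis
      by (rule has_sum_cong_neutral[THEN iffD1, rotated 3]) (auto simp: t_def)
  qed
  have "(\<Sum>\<^sub>\<infinity>\<nu>\<in>tuples k UNIV. mixed_diff k g \<nu> * (\<Prod>i<k. w i (\<nu> i)))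
      = (\<Sum>\<^sub>\<infinity>\<nu>\<in>tuples k UNIV. \<Sum>S\<in>Pow {..<k}. t S \<nu>)"
    by (simp add: mixed_diff_def t_def sum_distrib_right)
  also have "\<dots> = (\<Sum>S\<in>Pow {..<k}. infsum (u S) (tuples k UNIV))"
    by (intro infsumI has_sum_sum t) auto
  also have "\<dots> = (\<Sum>\<^sub>\<infinity>\<mu>\<in>tuples k UNIV. \<Sum>S\<in>Pow {..<k}. u S \<mu>)"
    by (intro infsumI[symmetric] has_sum_sum) (auto simp: u)
  also have "\<dots> = (\<Sum>\<^sub>\<infinity>\<mu>\<in>tuples k UNIV. g \<mu> * (\<Prod>i<k. w i (\<mu> i) - w i (Suc (\<mu> i))))"
  proof (intro infsum_cong)
    fix \<mu> :: "nat \<Rightarrow> nat"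
    \<comment> \<open>Expanding the product of differences over subsets recovers the signed sum of
      the terms \<open>u S\<close>.\<close>
    have "(\<Prod>i<k. w i (\<mu> i) - w i (Suc (\<mu> i))) =
        (\<Sum>S\<in>Pow {..<k}. (-1) ^ card S * (\<Prod>i\<in>S. w i (Suc (\<mu> i))) * (\<Prod>i\<in>{..<k}-S. w i (\<mu> i)))"
      by (rule prod_diff_conv_sum) auto
    also have "\<dots> = (\<Sum>S\<in>Pow {..<k}. (-1) ^ card S * (\<Prod>i<k. w i (\<mu> i + of_bool (i \<in> S))))"
    proof (intro sum.cong refl)
      fix S assume "S \<in> Pow {..<k}"
      hence "(\<Prod>i<k. w i (\<mu> i + of_bool (i \<in> S))) =
          (\<Prod>i\<in>{..<k}-S. w i (\<mu> i + of_bool (i \<in> S))) * (\<Prod>i\<in>S. w i (\<mu> i + of_bool (i \<in> S)))"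
        by (intro prod.subset_diff) auto
      thus "(-1) ^ card S * (\<Prod>i\<in>S. w i (Suc (\<mu> i))) * (\<Prod>i\<in>{..<k}-S. w i (\<mu> i)) =
          (-1) ^ card S * (\<Prod>i<k. w i (\<mu> i + of_bool (i \<in> S)))"
        by simp
    qed
    finally show "(\<Sum>S\<in>Pow {..<k}. u S \<mu>) = g \<mu> * (\<Prod>i<k. w i (\<mu> i) - w i (Suc (\<mu> i)))"
      by (simp add: u_def sum_distrib_left mult_ac)
  qed
  finally show ?thesis .
qed

text \<open>Summation by parts against the indicators of m \<le> \<open>\<nu> i\<close>: their
  differences are the indicators of m = \<open>\<nu> i\<close>, so the right-hand series collapses
  to its term at \<nu>.\<close>

lemma sum_mixed_diff:
  assumes g: "\<And>\<mu>. \<bar>g \<mu>\<bar> \<le> 1" and \<nu>: "\<nu> \<in> tuples k UNIV"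
  shows "(\<Sum>\<mu>\<in>PiE {..<k} (\<lambda>i. {..\<nu> i}). mixed_diff k g \<mu>) = g \<nu>"
proof -
  let ?w = "\<lambda>i m. of_bool (m \<le> \<nu> i) :: real"
  let ?B = "PiE {..<k} (\<lambda>i. {..\<nu> i})"
  have B: "finite ?B" "?B \<subseteq> tuples k UNIV"
    by (auto intro!: finite_PiE simp: tuples_def)
  have w: "?w i summable_on UNIV" for i
    by (rule finite_nonzero_values_imp_summable_on) (auto simp: atMost_def[symmetric])
  have prod_of_bool: "(\<Prod>i<k. of_bool (P i)) = (of_bool (\<forall>i<k. P i) :: real)" for P
    by (induction k) (auto simp: less_Suc_eq)
  have iff: "(\<forall>i<k. \<mu> i \<le> \<nu> i) \<longleftrightarrow> \<mu> \<in> ?B" if "\<mu> \<in> tuples k UNIV" for \<mu>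
    using that by (auto simp: tuples_def PiE_iff)
  have "(\<Sum>\<mu>\<in>?B. mixed_diff k g \<mu>)
      = (\<Sum>\<^sub>\<infinity>\<mu>\<in>tuples k UNIV. mixed_diff k g \<mu> * (\<Prod>i<k. ?w i (\<mu> i)))"
    unfolding prod_of_bool infsum_finite[OF B(1), symmetric]
    using iff B(2) by (intro infsum_cong_neutral) auto
  also have "\<dots> = (\<Sum>\<^sub>\<infinity>\<mu>\<in>tuples k UNIV. g \<mu> * (\<Prod>i<k. ?w i (\<mu> i) - ?w i (Suc (\<mu> i))))"
    by (intro infsum_mixed_diff g w)
  also have "\<dots> = (\<Sum>\<^sub>\<infinity>\<mu>\<in>{\<nu>}. g \<mu>)"
  proof (rule infsum_cong_neutral)
    have *: "(\<Prod>i<k. ?w i (\<mu> i) - ?w i (Suc (\<mu> i))) = of_bool (\<forall>i<k. \<mu> i = \<nu> i)" for \<mu>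
      unfolding prod_of_bool[symmetric] by (intro prod.cong) (auto simp: of_bool_def)
    show "g \<mu> * (\<Prod>i<k. ?w i (\<mu> i) - ?w i (Suc (\<mu> i))) = g \<mu>"
      if "\<mu> \<in> tuples k UNIV \<inter> {\<nu>}" for \<mu> using that by (simp add: *)
    show "g \<mu> * (\<Prod>i<k. ?w i (\<mu> i) - ?w i (Suc (\<mu> i))) = 0"
      if "\<mu> \<in> tuples k UNIV - {\<nu>}" for \<mu>
    proof -
      have "\<mu> = \<nu>" if "\<forall>i<k. \<mu> i = \<nu> i"
        using that \<nu> \<open>\<mu> \<in> _\<close> unfolding tuples_def
        by (intro PiE_ext[of \<mu> "{..<k}" "\<lambda>_. UNIV"]) auto
      thus ?thesis using that by (auto simp: *)
    qed
  qed (use \<nu> in auto)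
  finally show ?thesis by simp
qed

text \<open>Summation by parts with the weights q^m, whose differences are (1 - q) q^m. For q = 1/p
  this produces the factor (1 - 1/p)^k of an Euler factor.\<close>

lemma infsum_mixed_diff_geometric:
  fixes q :: real
  assumes g: "\<And>\<mu>. \<bar>g \<mu>\<bar> \<le> 1" and q: "0 \<le> q" "q < 1"
  shows "(\<Sum>\<^sub>\<infinity>\<nu>\<in>tuples k UNIV. mixed_diff k g \<nu> * q ^ (\<Sum>i<k. \<nu> i))
       = (1 - q) ^ k * (\<Sum>\<^sub>\<infinity>\<mu>\<in>tuples k UNIV. g \<mu> * q ^ (\<Sum>i<k. \<mu> i))"
proof -
  have "((^) q has_sum (1 / (1 - q))) UNIV"
    using q by (intro sums_nonneg_imp_has_sum geometric_sums) auto
  hence "(\<Sum>\<^sub>\<infinity>\<nu>\<in>tuples k UNIV. mixed_diff k g \<nu> * (\<Prod>i<k. q ^ \<nu> i))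
       = (\<Sum>\<^sub>\<infinity>\<mu>\<in>tuples k UNIV. g \<mu> * (\<Prod>i<k. q ^ \<mu> i - q ^ Suc (\<mu> i)))"
    by (intro infsum_mixed_diff g) (auto simp: has_sum_iff)
  also have "\<dots> = (\<Sum>\<^sub>\<infinity>\<mu>\<in>tuples k UNIV. (1 - q) ^ k * (g \<mu> * (\<Prod>i<k. q ^ \<mu> i)))"
  proof (intro infsum_cong)
    fix \<mu> :: "nat \<Rightarrow> nat"
    have "(\<Prod>i<k. q ^ \<mu> i - q ^ Suc (\<mu> i)) = (\<Prod>i<k. (1 - q) * q ^ \<mu> i)"
      by (simp add: algebra_simps)
    also have "\<dots> = (1 - q) ^ k * (\<Prod>i<k. q ^ \<mu> i)"
      by (simp add: prod.distrib)
    finally show "g \<mu> * (\<Prod>i<k. q ^ \<mu> i - q ^ Suc (\<mu> i)) = (1 - q) ^ k * (g \<mu> * (\<Prod>i<k. q ^ \<mu> i))"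
      by simp
  qed
  finally show ?thesis
    by (simp add: power_sum infsum_cmult_right')
qed

text \<open>A finite F carries all but e/2 of the absolute sum; once \<open>B N\<close> contains F,
  the missing part is at most that tail. This allows tuple sums to be ordered by the size of the
  prime factors.\<close>

lemma infsum_exhaustion_tendsto:
  fixes f :: "'a \<Rightarrow> real"
  assumes f: "f summable_on A" and B: "\<And>N. B N \<subseteq> A"
    and ev: "\<And>F. finite F \<Longrightarrow> F \<subseteq> A \<Longrightarrow> eventually (\<lambda>N. F \<subseteq> B N) G"
  shows "((\<lambda>N. infsum f (B N)) \<longlongrightarrow> infsum f A) G"
proof (rule tendstoI)
  fix e :: real assume "e > 0"
  have abs: "(\<lambda>x. norm (f x)) summable_on C" if "C \<subseteq> A" for C
    by (rule summable_on_iff_abs_summable_on_real[THEN iffD1])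
       (rule summable_on_subset_banach[OF f that])
  obtain F where F: "finite F" "F \<subseteq> A"
    and FA: "dist (\<Sum>x\<in>F. norm (f x)) (\<Sum>\<^sub>\<infinity>x\<in>A. norm (f x)) \<le> e / 2"
    using infsum_finite_approximation[OF abs[of A], of "e / 2"] \<open>e > 0\<close> by auto
  show "eventually (\<lambda>N. dist (infsum f (B N)) (infsum f A) < e) G"
    using ev[OF F]
  proof eventually_elim
    case (elim N)
    have "infsum f A - infsum f (B N) = infsum f (A - B N)"
      by (intro infsum_Diff[symmetric] f summable_on_subset_banach[OF f] B)
    hence "dist (infsum f (B N)) (infsum f A) = norm (infsum f (A - B N))"
      by (simp add: dist_norm norm_minus_commute)
    also have "\<dots> \<le> (\<Sum>\<^sub>\<infinity>x\<in>A - B N. norm (f x))"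
      by (intro norm_infsum_bound abs) auto
    also have "\<dots> \<le> (\<Sum>\<^sub>\<infinity>x\<in>A - F. norm (f x))"
      using elim by (intro infsum_mono_neutral abs) auto
    also have "\<dots> = (\<Sum>\<^sub>\<infinity>x\<in>A. norm (f x)) - (\<Sum>x\<in>F. norm (f x))"
      using F abs by (subst infsum_Diff) auto
    also have "\<dots> < e"
      using FA \<open>e > 0\<close> unfolding dist_real_def by linarith
    finally show ?case .
  qed
qed

subsection \<open>Multiplicative functions of several variables\<close>

definition exponents :: "nat \<Rightarrow> (nat \<Rightarrow> nat) \<Rightarrow> nat \<Rightarrow> nat \<Rightarrow> nat" where
  "exponents k n p = (\<lambda>i\<in>{..<k}. multiplicity p (n i))"

text \<open>A prime dividing no entry is left out, so this is the multiplicative function with local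
  values \<open>t p\<close> when \<open>t p\<close> equals 1 at the zero tuple. Positive entries
  make the product finite.\<close>

definition mult_fun :: "nat \<Rightarrow> (nat \<Rightarrow> (nat \<Rightarrow> nat) \<Rightarrow> real) \<Rightarrow> (nat \<Rightarrow> nat) \<Rightarrow> real" where
  "mult_fun k t n = (\<Prod>p | prime p \<and> (\<exists>i<k. p dvd n i). t p (exponents k n p))"

definition smooth_tuples :: "nat \<Rightarrow> nat set \<Rightarrow> (nat \<Rightarrow> nat) set" where
  "smooth_tuples k P = {n \<in> tuples k {0<..}. \<forall>i<k. prime_factors (n i) \<subseteq> P}"

lemma exponents_in_tuples [simp]: "exponents k n p \<in> tuples k UNIV"
  by (auto simp: exponents_def tuples_def)

lemma prod_prime_powers_superset:
  fixes m :: nat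
  assumes "m > 0" "finite P" "\<And>p. p \<in> P \<Longrightarrow> prime p" "prime_factors m \<subseteq> P"
  shows "(\<Prod>p\<in>P. p ^ multiplicity p m) = m"
proof -
  have "(\<Prod>p\<in>P. p ^ multiplicity p m) = (\<Prod>p\<in>prime_factors m. p ^ multiplicity p m)"
    using assms by (intro prod.mono_neutral_right) (auto simp: prime_factors_multiplicity)
  thus ?thesis using prime_factorization_nat[OF assms(1)] by simp
qed

lemma mult_fun_eq_prod:
  assumes n: "n \<in> smooth_tuples k P" and P: "finite P" "\<And>p. p \<in> P \<Longrightarrow> prime p"
    and t: "\<And>p. p \<in> P \<Longrightarrow> t p (\<lambda>i\<in>{..<k}. 0) = 1"
  shows "mult_fun k t n = (\<Prod>p\<in>P. t p (exponents k n p))"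
  unfolding mult_fun_def
proof (rule prod.mono_neutral_left)
  have pos: "n i > 0" if "i < k" for i
    using n that by (auto simp: smooth_tuples_def tuples_def PiE_iff)
  show "{p. prime p \<and> (\<exists>i<k. p dvd n i)} \<subseteq> P"
    using n pos by (auto simp: smooth_tuples_def prime_factors_dvd)
  show "\<forall>p\<in>P - {p. prime p \<and> (\<exists>i<k. p dvd n i)}. t p (exponents k n p) = 1"
  proof
    fix p assume p: "p \<in> P - {p. prime p \<and> (\<exists>i<k. p dvd n i)}"
    hence "exponents k n p = (\<lambda>i\<in>{..<k}. 0)"
      using P by (auto simp: exponents_def restrict_def fun_eq_iff not_dvd_imp_multiplicity_0)
    thus "t p (exponents k n p) = 1" using t p by simp
  qed
qed (use P in auto)

lemma finite_tuples_smooth: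
  assumes "finite F" "F \<subseteq> tuples k {0<..}"
  obtains P where "finite P" "\<And>p. p \<in> P \<Longrightarrow> prime p" "F \<subseteq> smooth_tuples k P"
proof
  let ?P = "\<Union>n\<in>F. \<Union>i<k. prime_factors (n i)"
  show "finite ?P" using assms by auto
  show "prime p" if "p \<in> ?P" for p using that by auto
  show "F \<subseteq> smooth_tuples k ?P" using assms by (auto simp: smooth_tuples_def)
qed

text \<open>Unique factorization in each coordinate. It turns a sum over smooth tuples into a sum
  over families of exponent tuples, one for each prime in P, and such a sum factors into local
  sums.\<close>

lemma bij_betw_exponents:
  assumes P: "finite P" "\<And>p. p \<in> P \<Longrightarrow> prime p"
  shows "bij_betw (\<lambda>n. \<lambda>p\<in>P. exponents k n p) (smooth_tuples k P) (PiE P (\<lambda>_. tuples k UNIV))"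
proof (rule bij_betw_byWitness[where f' = "\<lambda>e. \<lambda>i\<in>{..<k}. \<Prod>p\<in>P. p ^ e p i"])
  have mult: "multiplicity q (\<Prod>p\<in>P. p ^ f p) = (if q \<in> P then f q else 0)" if "prime q" for q f
    using P that by (intro multiplicity_prod_prime_powers)
  show "\<forall>n\<in>smooth_tuples k P. (\<lambda>i\<in>{..<k}. \<Prod>p\<in>P. p ^ (\<lambda>p\<in>P. exponents k n p) p i) = n"
  proof
    fix n assume n: "n \<in> smooth_tuples k P"
    have "(\<Prod>p\<in>P. p ^ (\<lambda>p\<in>P. exponents k n p) p i) = n i" if "i < k" for i
    proof -
      have "(\<Prod>p\<in>P. p ^ (\<lambda>p\<in>P. exponents k n p) p i) = (\<Prod>p\<in>P. p ^ multiplicity p (n i))"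
        using that by (intro prod.cong) (auto simp: exponents_def)
      also have "\<dots> = n i"
        using n that P
        by (intro prod_prime_powers_superset) (auto simp: smooth_tuples_def tuples_def PiE_iff)
      finally show ?thesis .
    qed
    thus "(\<lambda>i\<in>{..<k}. \<Prod>p\<in>P. p ^ (\<lambda>p\<in>P. exponents k n p) p i) = n"
      using n by (auto simp: fun_eq_iff smooth_tuples_def tuples_def PiE_iff extensional_def)
  qed
  show "\<forall>e\<in>PiE P (\<lambda>_. tuples k UNIV). (\<lambda>p\<in>P. exponents k (\<lambda>i\<in>{..<k}. \<Prod>p\<in>P. p ^ e p i) p) = e"
  proof
    fix e assume e: "e \<in> PiE P (\<lambda>_. tuples k UNIV)"
    have "exponents k (\<lambda>i\<in>{..<k}. \<Prod>p\<in>P. p ^ e p i) q = e q" if "q \<in> P" for q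
    proof -
      have "e q \<in> extensional {..<k}"
        using e that by (force simp: tuples_def PiE_iff)
      thus ?thesis
        using that P by (auto simp: exponents_def fun_eq_iff mult extensional_def)
    qed
    thus "(\<lambda>p\<in>P. exponents k (\<lambda>i\<in>{..<k}. \<Prod>p\<in>P. p ^ e p i) p) = e"
      using e by (auto simp: fun_eq_iff PiE_iff extensional_def)
  qed
  show "(\<lambda>n. \<lambda>p\<in>P. exponents k n p) ` smooth_tuples k P \<subseteq> PiE P (\<lambda>_. tuples k UNIV)"
    by auto
  show "(\<lambda>e. \<lambda>i\<in>{..<k}. \<Prod>p\<in>P. p ^ e p i) ` PiE P (\<lambda>_. tuples k UNIV) \<subseteq> smooth_tuples k P"
  proof (intro image_subsetI)
    fix e :: "nat \<Rightarrow> nat \<Rightarrow> nat"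
    have "(\<Prod>p\<in>P. p ^ e p i) > 0" for i
      using P by (intro prod_pos) (auto simp: prime_gt_0_nat)
    moreover have "prime_factors (\<Prod>p\<in>P. p ^ e p i) \<subseteq> P" for i
      by (auto simp: prime_factors_multiplicity mult split: if_splits)
    ultimately show "(\<lambda>i\<in>{..<k}. \<Prod>p\<in>P. p ^ e p i) \<in> smooth_tuples k P"
      by (auto simp: smooth_tuples_def tuples_def)
  qed
qed

text \<open>Divisibility is a componentwise inequality of exponents. Hence the divisor tuples of n
  correspond to independent choices, at each prime, of an exponent tuple below
  \<open>exponents k n p\<close>, and the sum factors.\<close>

lemma sum_mult_fun_divisors:
  assumes n: "n \<in> tuples k {0<..}" and t: "\<And>p. prime p \<Longrightarrow> t p (\<lambda>i\<in>{..<k}. 0) = 1"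
  shows "(\<Sum>d\<in>PiE {..<k} (\<lambda>i. {d. d dvd n i}). mult_fun k t d) =
         mult_fun k (\<lambda>p \<nu>. \<Sum>\<mu>\<in>PiE {..<k} (\<lambda>i. {..\<nu> i}). t p \<mu>) n"
proof -
  obtain P where P: "finite P" "\<And>p. p \<in> P \<Longrightarrow> prime p" "n \<in> smooth_tuples k P"
    using finite_tuples_smooth[of "{n}" k] n by auto
  have pos: "n i > 0" if "i < k" for i
    using n that by (auto simp: tuples_def PiE_iff)
  let ?D = "PiE {..<k} (\<lambda>i. {d. d dvd n i})"
  let ?E = "\<lambda>p. PiE {..<k} (\<lambda>i. {..exponents k n p i})"
  let ?\<Phi> = "\<lambda>n. \<lambda>p\<in>P. exponents k n p"
  have D: "?D \<subseteq> smooth_tuples k P"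
  proof
    fix d assume d: "d \<in> ?D"
    have "prime_factors (d i) \<subseteq> P" if "i < k" for i
    proof -
      have "prime_factors (d i) \<subseteq> prime_factors (n i)"
        using d that pos[OF that] by (intro dvd_prime_factors) (auto simp: PiE_iff)
      thus ?thesis using P(3) that by (auto simp: smooth_tuples_def)
    qed
    moreover have "d i > 0" if "i < k" for i
    proof -
      have "d i dvd n i" using d that by (auto simp: PiE_iff)
      thus ?thesis using pos[OF that] by (metis dvd_pos_nat)
    qed
    ultimately show "d \<in> smooth_tuples k P"
      using d by (auto simp: smooth_tuples_def tuples_def PiE_iff)
  qed
  have iff: "d \<in> ?D \<longleftrightarrow> ?\<Phi> d \<in> PiE P ?E" if d: "d \<in> smooth_tuples k P" for d
  proof -
    have dp: "d i > 0" "prime_factors (d i) \<subseteq> P" if "i < k" for i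
      using d that by (auto simp: smooth_tuples_def tuples_def PiE_iff)
    have "d i dvd n i \<longleftrightarrow> (\<forall>p\<in>P. multiplicity p (d i) \<le> multiplicity p (n i))" if i: "i < k" for i
    proof
      assume "d i dvd n i"
      thus "\<forall>p\<in>P. multiplicity p (d i) \<le> multiplicity p (n i)"
        using pos[OF i] by (auto intro: dvd_imp_multiplicity_le)
    next
      assume *: "\<forall>p\<in>P. multiplicity p (d i) \<le> multiplicity p (n i)"
      show "d i dvd n i"
      proof (rule multiplicity_le_imp_dvd)
        fix p :: nat assume "prime p"
        thus "multiplicity p (d i) \<le> multiplicity p (n i)"
          using * dp[OF i] by (cases "p \<in> P") (auto simp: prime_factors_multiplicity)
      qed (use dp[OF i] in auto)
    qed
    moreover have "d \<in> extensional {..<k}"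
      using d by (auto simp: smooth_tuples_def tuples_def PiE_iff)
    ultimately show ?thesis
      by (auto simp: PiE_iff exponents_def)
  qed
  have E: "PiE P ?E \<subseteq> PiE P (\<lambda>_. tuples k UNIV)"
    by (intro PiE_mono) (auto simp: tuples_def)
  have bij: "bij_betw ?\<Phi> ?D (PiE P ?E)"
  proof (rule bij_betw_subset[OF _ D])
    show bij: "bij_betw ?\<Phi> (smooth_tuples k P) (PiE P (\<lambda>_. tuples k UNIV))"
      by (rule bij_betw_exponents) (use P in auto)
    show "?\<Phi> ` ?D = PiE P ?E"
    proof (intro equalityI subsetI)
      fix e assume e: "e \<in> PiE P ?E"
      then obtain d where "d \<in> smooth_tuples k P" "e = ?\<Phi> d"
        using E bij unfolding bij_betw_def by blast
      thus "e \<in> ?\<Phi> ` ?D" using iff[of d] e by blast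
    next
      fix e assume "e \<in> ?\<Phi> ` ?D"
      thus "e \<in> PiE P ?E" using iff D by blast
    qed
  qed
  have "(\<Sum>d\<in>?D. mult_fun k t d) = (\<Sum>d\<in>?D. \<Prod>p\<in>P. t p (?\<Phi> d p))"
    using D P t by (intro sum.cong refl) (subst mult_fun_eq_prod[of _ k P], auto)
  also have "\<dots> = (\<Sum>e\<in>PiE P ?E. \<Prod>p\<in>P. t p (e p))"
    by (rule sum.reindex_bij_betw[OF bij])
  also have "\<dots> = (\<Prod>p\<in>P. \<Sum>\<mu>\<in>?E p. t p \<mu>)"
    using P by (intro prod_sum_PiE[symmetric] finite_PiE) auto
  also have "\<dots> = mult_fun k (\<lambda>p \<nu>. \<Sum>\<mu>\<in>PiE {..<k} (\<lambda>i. {..\<nu> i}). t p \<mu>) n"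
  proof (rule mult_fun_eq_prod[symmetric])
    \<comment> \<open>At the zero tuple the box of smaller exponent tuples is a singleton, so the
      summed local function is again 1 there, as \<open>mult_fun_eq_prod\<close> demands.\<close>
    have "PiE {..<k} (\<lambda>i. {..restrict (\<lambda>i. 0 :: nat) {..<k} i}) = {\<lambda>i\<in>{..<k}. 0}"
      by (simp add: PiE_eq_singleton)
    thus "(\<Sum>\<mu>\<in>PiE {..<k} (\<lambda>i. {..restrict (\<lambda>i. 0 :: nat) {..<k} i}). t p \<mu>) = 1" if "p \<in> P" for p
      using t P that by simp
  qed (use P in auto)
  finally show ?thesis .
qed

subsection \<open>Euler products\<close>

text \<open>
  If the local factors vanish at tuples of degree strictly between \<open>0\<close> and \<open>j\<close>, then the local
  sum at \<open>p\<close> is \<open>1 + O(p\<^bsup>-j\<sigma>\<^esup>)\<close>.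
\<close>

locale local_factors =
  fixes k j :: nat and t :: "nat \<Rightarrow> (nat \<Rightarrow> nat) \<Rightarrow> real" and M \<sigma> :: real
  assumes one: "\<And>p. prime p \<Longrightarrow> t p (\<lambda>i\<in>{..<k}. 0) = 1"
    and gap: "\<And>p \<nu>. prime p \<Longrightarrow> \<nu> \<in> tuples k UNIV \<Longrightarrow> 0 < (\<Sum>i<k. \<nu> i) \<Longrightarrow> (\<Sum>i<k. \<nu> i) < j \<Longrightarrow> t p \<nu> = 0"
    and bound: "\<And>p \<nu>. prime p \<Longrightarrow> \<nu> \<in> tuples k UNIV \<Longrightarrow>
      \<bar>t p \<nu>\<bar> \<le> M * (real p powr (-\<sigma>)) ^ (\<Sum>i<k. \<nu> i)"
    and sigma_pos: "\<sigma> > 0" and j_sigma: "real j * \<sigma> > 1"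
begin

text \<open>The sum of the majorant M (q/q0)^j q0^|\<nu>| over all tuples \<nu>, where q =
  p^(-\<sigma>), q0 = 2^(-\<sigma>) and |\<nu>| is the degree of \<nu>.\<close>

definition local_error :: "nat \<Rightarrow> real" where
  "local_error p = M * (2 powr \<sigma>) ^ j * (1 / (1 - 2 powr (-\<sigma>))) ^ k * real p powr (-(real j * \<sigma>))"

lemma M_ge_1: "M \<ge> 1"
  using bound[of 2 "\<lambda>i\<in>{..<k}. 0"] one[of 2] by (auto simp: tuples_def)

lemma abs_local_sub_one:
  assumes p: "prime p"
  shows "(\<lambda>\<nu>. t p \<nu> - of_bool (\<nu> = (\<lambda>i\<in>{..<k}. 0))) summable_on tuples k UNIV"
    and "(\<Sum>\<^sub>\<infinity>\<nu>\<in>tuples k UNIV. \<bar>t p \<nu> - of_bool (\<nu> = (\<lambda>i\<in>{..<k}. 0))\<bar>) \<le> local_error p"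
proof -
  let ?Z = "\<lambda>i\<in>{..<k}. 0 :: nat"
  define q where "q = real p powr (-\<sigma>)"
  \<comment> \<open>The prime 2 gives the largest value of \<open>q\<close>, so \<open>q0\<close> is
    a ratio below 1 that serves all primes.\<close>
  define q0 where "q0 = (2 :: real) powr (-\<sigma>)"
  have q: "0 < q0" "q0 < 1" "0 \<le> q" "q \<le> q0"
    using sigma_pos prime_ge_2_nat[OF p]
    by (auto simp: q_def q0_def powr_less_one intro!: powr_mono2')
  let ?m = "\<lambda>\<nu>. M * (q / q0) ^ j * q0 ^ (\<Sum>i<k. \<nu> i)"
  have le: "norm (t p \<nu> - of_bool (\<nu> = ?Z)) \<le> ?m \<nu>" if \<nu>: "\<nu> \<in> tuples k UNIV" for \<nu>
  proof -
    have m0: "0 \<le> ?m \<nu>"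
      using q M_ge_1 by (intro mult_nonneg_nonneg) auto
    \<comment> \<open>At the zero tuple the indicator cancels the value 1; in degrees strictly
      between 0 and j the term vanishes by \<open>gap\<close>; from degree j on,
      \<open>bound\<close> and the geometric majorant apply.\<close>
    consider "\<nu> = ?Z" | "\<nu> \<noteq> ?Z" "(\<Sum>i<k. \<nu> i) < j" | "\<nu> \<noteq> ?Z" "(\<Sum>i<k. \<nu> i) \<ge> j"
      by linarith
    thus ?thesis
    proof cases
      case 1
      thus ?thesis using one[OF p] m0 by simp
    next
      case 2
      have "\<exists>i<k. \<nu> i \<noteq> 0"
        using \<nu> \<open>\<nu> \<noteq> ?Z\<close> by (auto simp: tuples_def fun_eq_iff PiE_iff extensional_def split: if_splits)
      hence "0 < (\<Sum>i<k. \<nu> i)" by (force simp: sum_pos2)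
      thus ?thesis using gap[OF p \<nu>] 2 m0 by simp
    next
      case 3
      have "\<bar>t p \<nu>\<bar> \<le> M * q ^ (\<Sum>i<k. \<nu> i)"
        using bound[OF p \<nu>] by (simp add: q_def)
      also have "\<dots> \<le> M * ((q / q0) ^ j * q0 ^ (\<Sum>i<k. \<nu> i))"
        using q 3 M_ge_1 by (intro mult_left_mono power_le_geometric_majorant) auto
      finally show ?thesis using 3 by (simp add: mult_ac)
    qed
  qed
  have m: "(?m has_sum (M * (q / q0) ^ j * (1 / (1 - q0)) ^ k)) (tuples k UNIV)"
    using summable_on_geometric_tuples[of q0 k] infsum_geometric_tuples[of q0 k] q
    by (intro has_sum_cmult_right) (auto simp: has_sum_iff)
  have abs: "(\<lambda>\<nu>. norm (t p \<nu> - of_bool (\<nu> = ?Z))) summable_on tuples k UNIV"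
    by (rule summable_on_comparison_test[OF has_sum_imp_summable[OF m] le norm_ge_zero])
  thus "(\<lambda>\<nu>. t p \<nu> - of_bool (\<nu> = ?Z)) summable_on tuples k UNIV"
    by (rule abs_summable_summable)
  have "(\<Sum>\<^sub>\<infinity>\<nu>\<in>tuples k UNIV. norm (t p \<nu> - of_bool (\<nu> = ?Z))) \<le> infsum ?m (tuples k UNIV)"
    by (intro infsum_mono abs le has_sum_imp_summable[OF m])
  also have "\<dots> = M * (q / q0) ^ j * (1 / (1 - q0)) ^ k"
    by (rule infsumI[OF m])
  also have "(q / q0) ^ j = (2 powr \<sigma>) ^ j * real p powr (-(real j * \<sigma>))"
  proof -
    have "q / q0 = 2 powr \<sigma> * real p powr (-\<sigma>)"
      by (simp add: q_def q0_def powr_minus divide_inverse mult_ac)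
    thus ?thesis
      using prime_gt_0_nat[OF p] by (simp add: power_mult_distrib powr_power)
  qed
  finally show "(\<Sum>\<^sub>\<infinity>\<nu>\<in>tuples k UNIV. \<bar>t p \<nu> - of_bool (\<nu> = ?Z)\<bar>) \<le> local_error p"
    by (simp only: local_error_def q0_def mult_ac real_norm_def)
qed

lemma indicator_zero_has_sum:
  "((\<lambda>\<nu>. of_bool (\<nu> = (\<lambda>i\<in>{..<k}. 0)) :: real) has_sum 1) (tuples k UNIV)"
  by (rule has_sum_finite_neutralI[of "{\<lambda>i\<in>{..<k}. 0}"]) (auto simp: tuples_def)

lemma local_summable:
  assumes "prime p"
  shows "t p summable_on tuples k UNIV"
proof -
  have "(\<lambda>\<nu>. (t p \<nu> - of_bool (\<nu> = (\<lambda>i\<in>{..<k}. 0))) + of_bool (\<nu> = (\<lambda>i\<in>{..<k}. 0)))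
          summable_on tuples k UNIV"
    using abs_local_sub_one(1)[OF assms] indicator_zero_has_sum
    by (intro summable_on_add) (auto simp: has_sum_iff)
  thus ?thesis by simp
qed

lemma local_abs_summable:
  assumes "prime p"
  shows "(\<lambda>\<nu>. \<bar>t p \<nu>\<bar>) summable_on tuples k UNIV"
  using local_summable[OF assms] summable_on_iff_abs_summable_on_real[of "t p"] by simp

lemma abs_local_sum_le:
  assumes p: "prime p"
  shows "(\<Sum>\<^sub>\<infinity>\<nu>\<in>tuples k UNIV. \<bar>t p \<nu>\<bar>) \<le> 1 + local_error p"
    and "\<bar>infsum (t p) (tuples k UNIV) - 1\<bar> \<le> local_error p"
proof -
  let ?e = "\<lambda>\<nu>. t p \<nu> - of_bool (\<nu> = (\<lambda>i\<in>{..<k}. 0))"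
  note e = abs_local_sub_one[OF p]
  have abs: "(\<lambda>\<nu>. norm (?e \<nu>)) summable_on tuples k UNIV"
    by (rule summable_on_iff_abs_summable_on_real[THEN iffD1, OF e(1)])
  have "(\<Sum>\<^sub>\<infinity>\<nu>\<in>tuples k UNIV. \<bar>t p \<nu>\<bar>) \<le>
        (\<Sum>\<^sub>\<infinity>\<nu>\<in>tuples k UNIV. of_bool (\<nu> = (\<lambda>i\<in>{..<k}. 0)) + norm (?e \<nu>))"
    using abs indicator_zero_has_sum
    by (intro infsum_mono summable_on_add local_abs_summable[OF p]) (auto simp: has_sum_iff)
  also have "\<dots> = 1 + (\<Sum>\<^sub>\<infinity>\<nu>\<in>tuples k UNIV. norm (?e \<nu>))"
    using abs indicator_zero_has_sum by (subst infsum_add) (auto simp: has_sum_iff)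
  finally show "(\<Sum>\<^sub>\<infinity>\<nu>\<in>tuples k UNIV. \<bar>t p \<nu>\<bar>) \<le> 1 + local_error p"
    using e(2) by simp
  have "((\<lambda>\<nu>. ?e \<nu> + of_bool (\<nu> = (\<lambda>i\<in>{..<k}. 0))) has_sum (infsum ?e (tuples k UNIV) + 1))
          (tuples k UNIV)"
    using e(1) by (intro has_sum_add indicator_zero_has_sum) (simp add: has_sum_iff)
  hence "infsum (t p) (tuples k UNIV) - 1 = infsum ?e (tuples k UNIV)"
    by (simp add: has_sum_iff)
  also have "norm \<dots> \<le> (\<Sum>\<^sub>\<infinity>\<nu>\<in>tuples k UNIV. norm (?e \<nu>))"
    by (rule norm_infsum_bound[OF abs])
  finally show "\<bar>infsum (t p) (tuples k UNIV) - 1\<bar> \<le> local_error p"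
    using e(2) by (simp only: real_norm_def)
qed

lemma local_error_nonneg: "local_error p \<ge> 0"
proof -
  have "2 powr (-\<sigma>) < (1 :: real)" using sigma_pos by (simp add: powr_less_one)
  thus ?thesis using M_ge_1 by (simp add: local_error_def)
qed

lemma summable_local_error: "summable local_error"
  unfolding local_error_def using j_sigma
  by (intro summable_mult) (simp add: summable_real_powr_iff)

definition euler :: "nat \<Rightarrow> real" where
  "euler p = (if prime p then infsum (t p) (tuples k UNIV) else 1)"

lemma convergent_prod_euler: "convergent_prod euler"
proof -
  have "summable (\<lambda>p. norm (euler p - 1))"
  proof (rule summable_comparison_test[OF _ summable_local_error], intro exI allI impI)
    fix p show "norm (norm (euler p - 1)) \<le> local_error p"
      using abs_local_sum_le(2)[of p] local_error_nonneg[of p] by (auto simp: euler_def)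
  qed
  thus ?thesis
    by (intro abs_convergent_prod_imp_convergent_prod) (simp add: abs_convergent_prod_conv_summable)
qed

text \<open>Stated for an arbitrary \<open>u\<close> because it is applied both to \<open>t\<close>
  and to the absolute values of \<open>t\<close>.\<close>

lemma has_sum_smooth:
  assumes P: "finite P" "\<And>p. p \<in> P \<Longrightarrow> prime p"
    and u: "\<And>p. prime p \<Longrightarrow> u p (\<lambda>i\<in>{..<k}. 0) = 1"
      "\<And>p. prime p \<Longrightarrow> u p summable_on tuples k UNIV"
  shows "(mult_fun k u has_sum (\<Prod>p\<in>P. infsum (u p) (tuples k UNIV))) (smooth_tuples k P)"
proof -
  let ?\<Phi> = "\<lambda>n. \<lambda>p\<in>P. exponents k n p"
  have "((\<lambda>e. \<Prod>p\<in>P. u p (e p)) has_sum (\<Prod>p\<in>P. infsum (u p) (tuples k UNIV)))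
          (PiE P (\<lambda>_. tuples k UNIV))"
    using summable_prod_PiE_real[of P u "\<lambda>_. tuples k UNIV"]
      infsum_prod_PiE_real[of P u "\<lambda>_. tuples k UNIV"] P u
    by (auto simp: has_sum_iff)
  hence "((\<lambda>n. \<Prod>p\<in>P. u p (?\<Phi> n p)) has_sum (\<Prod>p\<in>P. infsum (u p) (tuples k UNIV)))
          (smooth_tuples k P)"
    by (subst has_sum_reindex_bij_betw[OF bij_betw_exponents[OF P], where f = "\<lambda>e. \<Prod>p\<in>P. u p (e p)"])
  thus ?thesis
    by (rule has_sum_cong[THEN iffD1, rotated])
       (use P u in \<open>auto simp: mult_fun_eq_prod[of _ k P]\<close>)
qed

text \<open>Finitely many tuples involve finitely many primes, so a finite sum of absolute values is
  at most a product of factors 1 + \<open>local_error p\<close>, hence at most the exponential of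
  the convergent sum of \<open>local_error\<close>.\<close>

lemma mult_fun_summable: "mult_fun k t summable_on tuples k {0<..}"
proof -
  let ?u = "\<lambda>p \<nu>. \<bar>t p \<nu>\<bar>"
  have abs: "norm (mult_fun k t n) = mult_fun k ?u n" for n
    by (simp add: mult_fun_def abs_prod)
  have "(\<lambda>n. norm (mult_fun k t n)) summable_on tuples k {0<..}"
  proof (rule nonneg_bdd_above_summable_on)
    show "bdd_above (sum (\<lambda>n. norm (mult_fun k t n)) ` {F. F \<subseteq> tuples k {0<..} \<and> finite F})"
    proof (intro bdd_aboveI2)
      fix F assume "F \<in> {F. F \<subseteq> tuples k {0<..} \<and> finite F}"
      then obtain P where P: "finite P" "\<And>p. p \<in> P \<Longrightarrow> prime p" "F \<subseteq> smooth_tuples k P"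
        and F: "finite F"
        using finite_tuples_smooth[of F k] by blast
      have "(mult_fun k ?u has_sum (\<Prod>p\<in>P. infsum (?u p) (tuples k UNIV))) (smooth_tuples k P)"
        using P by (intro has_sum_smooth) (auto simp: one local_abs_summable)
      hence "(\<Sum>n\<in>F. mult_fun k ?u n) \<le> (\<Prod>p\<in>P. infsum (?u p) (tuples k UNIV))"
        by (rule finite_sum_le_has_sum[OF _ F P(3)]) (simp flip: abs)
      also have "\<dots> \<le> (\<Prod>p\<in>P. exp (local_error p))"
      proof (intro prod_mono conjI)
        fix p assume "p \<in> P"
        hence "prime p" using P by blast
        from abs_local_sum_le(1)[OF this] exp_ge_add_one_self[of "local_error p"]
        show "infsum (?u p) (tuples k UNIV) \<le> exp (local_error p)" by linarith
      qed (auto intro: infsum_nonneg)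
      also have "\<dots> = exp (\<Sum>p\<in>P. local_error p)"
        using P by (simp add: exp_sum)
      also have "\<dots> \<le> exp (suminf local_error)"
        using P by (auto intro!: sum_le_suminf summable_local_error simp: local_error_nonneg)
      finally show "(\<Sum>n\<in>F. norm (mult_fun k t n)) \<le> exp (suminf local_error)"
        by (simp only: abs)
    qed
  qed auto
  thus ?thesis by (rule abs_summable_summable)
qed

text \<open>The partial product up to N is the sum over the tuples all of whose prime factors are at
  most N. These sets exhaust the positive tuples, and summability identifies the limit.\<close>

lemma euler_product: "infsum (mult_fun k t) (tuples k {0<..}) = prodinf euler"
proof (rule LIMSEQ_unique)
  let ?P = "\<lambda>N. {p. prime p \<and> p \<le> N}"
  have "infsum (mult_fun k t) (smooth_tuples k (?P N)) = (\<Prod>p\<le>N. euler p)" for N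
  proof -
    have "infsum (mult_fun k t) (smooth_tuples k (?P N)) = (\<Prod>p\<in>?P N. infsum (t p) (tuples k UNIV))"
      by (intro infsumI has_sum_smooth one local_summable) auto
    also have "\<dots> = (\<Prod>p\<in>?P N. euler p)"
      by (intro prod.cong) (auto simp: euler_def)
    also have "\<dots> = (\<Prod>p\<le>N. euler p)"
      by (intro prod.mono_neutral_left) (auto simp: euler_def)
    finally show ?thesis .
  qed
  thus "(\<lambda>N. infsum (mult_fun k t) (smooth_tuples k (?P N))) \<longlonglongrightarrow> prodinf euler"
    using convergent_prod_LIMSEQ[OF convergent_prod_euler] by simp
  show "(\<lambda>N. infsum (mult_fun k t) (smooth_tuples k (?P N))) \<longlonglongrightarrow> infsum (mult_fun k t) (tuples k {0<..})"
  proof (rule infsum_exhaustion_tendsto[OF mult_fun_summable])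
    show "smooth_tuples k (?P N) \<subseteq> tuples k {0<..}" for N
      by (auto simp: smooth_tuples_def)
    fix F assume F: "finite F" "F \<subseteq> tuples k {0<..}"
    then obtain P where P: "finite P" "\<And>p. p \<in> P \<Longrightarrow> prime p" "F \<subseteq> smooth_tuples k P"
      using finite_tuples_smooth[of F k] by blast
    obtain N0 where N0: "\<And>p. p \<in> P \<Longrightarrow> p \<le> N0"
      using P(1) finite_nat_set_iff_bounded_le by auto
    show "eventually (\<lambda>N. F \<subseteq> smooth_tuples k (?P N)) sequentially"
      using eventually_ge_at_top[of N0]
    proof eventually_elim
      case (elim N)
      have "P \<subseteq> ?P N" using P N0 elim by force
      hence "smooth_tuples k P \<subseteq> smooth_tuples k (?P N)"
        unfolding smooth_tuples_def by blast
      thus ?case using P(3) by (rule order.trans[rotated])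
    qed
  qed
qed

end

subsection \<open>Zeta and the least common multiple\<close>

text \<open>The local values of the product of the \<open>n i powr (-s)\<close>, written as a
  natural power so that the geometric series over tuples applies directly.\<close>

definition weight :: "nat \<Rightarrow> real \<Rightarrow> nat \<Rightarrow> (nat \<Rightarrow> nat) \<Rightarrow> real" where
  "weight k s p \<nu> = (real p powr (-s)) ^ (\<Sum>i<k. \<nu> i)"

lemma power_powr_comm: "0 \<le> x \<Longrightarrow> (x ^ m) powr a = (x powr a) ^ m" for x a :: real
  by (induction m) (auto simp: powr_mult)

lemma mult_fun_mult: "mult_fun k (\<lambda>p \<nu>. t p \<nu> * u p \<nu>) n = mult_fun k t n * mult_fun k u n"
  by (simp add: mult_fun_def prod.distrib)

lemma mult_fun_cong:
  "(\<And>p \<nu>. prime p \<Longrightarrow> \<nu> \<in> tuples k UNIV \<Longrightarrow> t p \<nu> = u p \<nu>) \<Longrightarrow> mult_fun k t n = mult_fun k u n"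
  unfolding mult_fun_def by (intro prod.cong) auto

lemma mult_fun_weight:
  assumes "n \<in> tuples k {0<..}"
  shows "mult_fun k (weight k s) n = (\<Prod>i<k. real (n i) powr (-s))"
proof -
  obtain P where P: "finite P" "\<And>p. p \<in> P \<Longrightarrow> prime p" "n \<in> smooth_tuples k P"
    using finite_tuples_smooth[of "{n}" k] assms by auto
  have "mult_fun k (weight k s) n = (\<Prod>p\<in>P. weight k s p (exponents k n p))"
    by (rule mult_fun_eq_prod[OF P(3,1)]) (use P in \<open>auto simp: weight_def\<close>)
  also have "\<dots> = (\<Prod>p\<in>P. \<Prod>i<k. (real p ^ multiplicity p (n i)) powr (-s))"
    by (simp add: weight_def exponents_def power_sum power_powr_comm)
  also have "\<dots> = (\<Prod>i<k. \<Prod>p\<in>P. (real p ^ multiplicity p (n i)) powr (-s))"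
    by (rule prod.swap)
  also have "\<dots> = (\<Prod>i<k. real (n i) powr (-s))"
  proof (intro prod.cong refl)
    fix i assume i: "i \<in> {..<k}"
    have "(\<Prod>p\<in>P. (real p ^ multiplicity p (n i)) powr (-s)) =
          real (\<Prod>p\<in>P. p ^ multiplicity p (n i)) powr (-s)"
      by (simp add: prod_powr_distrib)
    also have "(\<Prod>p\<in>P. p ^ multiplicity p (n i)) = n i"
      using P i by (intro prod_prime_powers_superset) (auto simp: smooth_tuples_def tuples_def PiE_iff)
    finally show "(\<Prod>p\<in>P. (real p ^ multiplicity p (n i)) powr (-s)) = real (n i) powr (-s)" .
  qed
  finally show ?thesis .
qed

section \<open>Zeta as an Euler product in one variable\<close>

lemma zeta_has_prod:
  assumes s: "s > 1"
  shows "(\<lambda>p. if prime p then 1 / (1 - real p powr (-s)) else 1) has_prod zeta s"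
proof -
  \<comment> \<open>In one variable the local sums are geometric series in p^(-s), and j = 1 is
    enough because s > 1.\<close>
  interpret local_factors 1 1 "weight 1 s" 1 s
    using s by unfold_locales (auto simp: weight_def)
  have "euler p = (if prime p then 1 / (1 - real p powr (-s)) else 1)" for p
  proof (cases "prime p")
    case True
    have "real p powr (-s) < 1"
      using prime_gt_1_nat[OF True] s by (intro powr_less_one) auto
    thus ?thesis
      using True infsum_geometric_tuples[of "real p powr (-s)" 1] unfolding euler_def weight_def
      by simp
  qed (simp only: euler_def if_False)
  hence euler: "euler = (\<lambda>p. if prime p then 1 / (1 - real p powr (-s)) else 1)" by blast
  \<comment> \<open>Positive 1-tuples are indexed through \<open>Suc m\<close> to match the series
    of \<open>zeta\<close>, whose index starts at 0.\<close>
  have "bij_betw (\<lambda>m. \<lambda>i\<in>{..<1}. Suc m) UNIV (tuples 1 {0<..})"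
  proof (rule bij_betw_byWitness[where f' = "\<lambda>n. n 0 - 1"])
    show "\<forall>n\<in>tuples 1 {0<..}. (\<lambda>i\<in>{..<1}. Suc (n 0 - 1)) = n"
      by (auto simp: tuples_def fun_eq_iff PiE_iff extensional_def)
  qed (auto simp: tuples_def split: if_splits)
  note bij = this
  have "(mult_fun 1 (weight 1 s) has_sum prodinf euler) (tuples 1 {0<..})"
    using mult_fun_summable euler_product by (simp add: has_sum_iff)
  hence "((\<lambda>m. mult_fun 1 (weight 1 s) (\<lambda>i\<in>{..<1}. Suc m)) has_sum prodinf euler) UNIV"
    by (subst has_sum_reindex_bij_betw[OF bij, where f = "mult_fun 1 (weight 1 s)"])
  also have "(\<lambda>m. mult_fun 1 (weight 1 s) (\<lambda>i\<in>{..<1}. Suc m)) = (\<lambda>m. 1 / real (Suc m) powr s)"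
  proof
    fix m
    have "(\<lambda>i\<in>{..<1}. Suc m) \<in> tuples 1 {0<..}" by (auto simp: tuples_def)
    thus "mult_fun 1 (weight 1 s) (\<lambda>i\<in>{..<1}. Suc m) = 1 / real (Suc m) powr s"
      by (subst mult_fun_weight) (auto simp: powr_minus_divide)
  qed
  finally have zeta: "zeta s = prodinf euler"
    unfolding zeta_def by (intro sums_unique[symmetric] has_sum_imp_sums)
  show ?thesis
    unfolding zeta euler[symmetric] by (rule convergent_prod_has_prod[OF convergent_prod_euler])
qed

section \<open>Lcm and gcd through prime exponents\<close>

lemma multiplicity_Lcm_Gcd:
  fixes A :: "nat set"
  assumes "finite A" "A \<noteq> {}" "0 \<notin> A" "prime p"
  shows "multiplicity p (Lcm A) = Max (multiplicity p ` A)"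
    and "multiplicity p (Gcd A) = Min (multiplicity p ` A)"
proof -
  have "multiplicity p (Lcm A) = Max (multiplicity p ` A) \<and>
        multiplicity p (Gcd A) = Min (multiplicity p ` A)"
    using assms
  proof (induction A rule: finite_ne_induct)
    case (insert a A)
    have "Lcm A \<noteq> 0" "Gcd A \<noteq> 0"
      using insert by (auto simp: Lcm_0_iff Gcd_0_iff)
    thus ?case
      using insert by (simp add: multiplicity_lcm multiplicity_gcd)
  qed auto
  thus "multiplicity p (Lcm A) = Max (multiplicity p ` A)"
    and "multiplicity p (Gcd A) = Min (multiplicity p ` A)" by auto
qed

text \<open>The local values of (lcm/gcd)^r: the exponents of p in the lcm and the gcd are the
  maximum and the minimum of the exponents in the entries.\<close>

definition spread :: "real \<Rightarrow> nat \<Rightarrow> nat \<Rightarrow> (nat \<Rightarrow> nat) \<Rightarrow> real" where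
  "spread r k p \<nu> = real p powr (r * (real (tuple_max k \<nu>) - real (tuple_min k \<nu>)))"

lemma mult_fun_spread:
  assumes n: "n \<in> tuples k {0<..}" and k: "k > 0"
  shows "mult_fun k (spread r k) n = (real (Lcm (n ` {..<k})) / real (Gcd (n ` {..<k}))) powr r"
proof -
  obtain P where P: "finite P" "\<And>p. p \<in> P \<Longrightarrow> prime p" "n \<in> smooth_tuples k P"
    using finite_tuples_smooth[of "{n}" k] n by auto
  let ?A = "n ` {..<k}"
  have A: "finite ?A" "?A \<noteq> {}" "0 \<notin> ?A"
    using n k by (force simp: tuples_def PiE_iff)+
  have nz: "Lcm ?A > 0" "Gcd ?A > 0"
    using A by (force simp: Lcm_0_iff Gcd_0_iff intro!: Nat.gr0I)+
  have "multiplicity p ` ?A = exponents k n p ` {..<k}" for p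
    by (auto simp: exponents_def image_iff)
  hence mult: "multiplicity p (Lcm ?A) = tuple_max k (exponents k n p)"
    "multiplicity p (Gcd ?A) = tuple_min k (exponents k n p)" if "prime p" for p
    using multiplicity_Lcm_Gcd[OF A that] by (auto simp: tuple_max_def tuple_min_def)
  have "multiplicity p m = 0" if "m \<in> ?A" "prime p" "p \<notin> P" for m p
    using that P(3) by (auto simp: smooth_tuples_def prime_factors_multiplicity)
  hence zero: "multiplicity p ` ?A = {0}" if "prime p" "p \<notin> P" for p
    using that A(2) by (auto simp: image_iff)
  \<comment> \<open>Primes outside P divide no entry, hence neither the lcm nor the gcd; both are
    therefore recovered from their prime powers over P.\<close>
  have sub: "prime_factors (Lcm ?A) \<subseteq> P" "prime_factors (Gcd ?A) \<subseteq> P"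
  proof -
    have "multiplicity p (Lcm ?A) = 0 \<and> multiplicity p (Gcd ?A) = 0" if "prime p" "p \<notin> P" for p
      using multiplicity_Lcm_Gcd[OF A \<open>prime p\<close>] zero[OF that]
      by simp
    thus "prime_factors (Lcm ?A) \<subseteq> P" "prime_factors (Gcd ?A) \<subseteq> P"
      unfolding prime_factors_multiplicity by (metis (no_types, lifting) less_irrefl mem_Collect_eq subsetI)+
  qed
  have "mult_fun k (spread r k) n = (\<Prod>p\<in>P. spread r k p (exponents k n p))"
    using k by (intro mult_fun_eq_prod[OF P(3,1)])
      (use P in \<open>auto simp: spread_def tuple_max_def tuple_min_def prime_gt_0_nat image_constant_conv\<close>)
  also have "\<dots> = (\<Prod>p\<in>P. (real (p ^ multiplicity p (Lcm ?A)) / real (p ^ multiplicity p (Gcd ?A))) powr r)"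
  proof (intro prod.cong refl)
    fix p assume "p \<in> P"
    hence "prime p" using P by blast
    hence "real p > 0" by (simp add: prime_gt_0_nat)
    thus "spread r k p (exponents k n p) =
      (real (p ^ multiplicity p (Lcm ?A)) / real (p ^ multiplicity p (Gcd ?A))) powr r"
      unfolding spread_def mult[OF \<open>prime p\<close>]
      by (simp add: mult.commute[of r] powr_diff flip: powr_powr powr_realpow)
  qed
  also have "\<dots> = (real (\<Prod>p\<in>P. p ^ multiplicity p (Lcm ?A)) /
                  real (\<Prod>p\<in>P. p ^ multiplicity p (Gcd ?A))) powr r"
    by (simp flip: prod_powr_distrib add: prod_dividef)
  also have "(\<Prod>p\<in>P. p ^ multiplicity p (Lcm ?A)) = Lcm ?A"
    by (intro prod_prime_powers_superset sub P nz)
  also have "(\<Prod>p\<in>P. p ^ multiplicity p (Gcd ?A)) = Gcd ?A"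
    by (intro prod_prime_powers_superset sub P nz)
  finally show ?thesis .
qed

subsection \<open>The constants C and D\<close>

lemma tuple_max_le_sum: "k > 0 \<Longrightarrow> tuple_max k \<nu> \<le> (\<Sum>i<k. \<nu> i)"
  unfolding tuple_max_def by (subst Max_le_iff) (auto intro!: member_le_sum)

text \<open>The local values of the quotient g: the factor \<open>weight k r\<close> divides by the
  r-th power of the product of the entries.\<close>

definition normalized :: "real \<Rightarrow> nat \<Rightarrow> nat \<Rightarrow> (nat \<Rightarrow> nat) \<Rightarrow> real" where
  "normalized r k p \<nu> = spread r k p \<nu> * weight k r p \<nu>"

lemma weight_altdef: "p > 0 \<Longrightarrow> weight k s p \<nu> = real p powr (- (s * real (\<Sum>i<k. \<nu> i)))"
  by (simp add: weight_def powr_power mult_ac)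

lemma normalized_nonneg: "normalized r k p \<nu> \<ge> 0"
  by (simp add: normalized_def spread_def weight_def)

text \<open>The largest exponent is at most the sum of all exponents, so the total power of p is
  nonpositive.\<close>

lemma normalized_le_1:
  assumes "k > 0" "r > 0" "prime p"
  shows "normalized r k p \<nu> \<le> 1"
proof -
  have p: "real p > 1" using prime_gt_1_nat[OF assms(3)] by simp
  have "normalized r k p \<nu> =
      real p powr (r * (real (tuple_max k \<nu>) - real (tuple_min k \<nu>) - real (\<Sum>i<k. \<nu> i)))"
    using p by (simp add: normalized_def spread_def weight_altdef algebra_simps flip: powr_add)
  also have "\<dots> \<le> real p powr 0"
  proof (intro powr_mono mult_nonneg_nonpos)
    have "real (tuple_max k \<nu>) \<le> real (\<Sum>i<k. \<nu> i)"
      using tuple_max_le_sum[OF assms(1)] by (rule of_nat_mono)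
    thus "real (tuple_max k \<nu>) - real (tuple_min k \<nu>) - real (\<Sum>i<k. \<nu> i) \<le> 0"
      by linarith
  qed (use p assms(2) in auto)
  finally show ?thesis using p by simp
qed

lemma abs_normalized_le_1: "k > 0 \<Longrightarrow> r > 0 \<Longrightarrow> prime p \<Longrightarrow> \<bar>normalized r k p \<nu>\<bar> \<le> 1"
  using normalized_le_1[of k r p \<nu>] normalized_nonneg[of r k p \<nu>] by simp

lemma D_term_eq: "prime p \<Longrightarrow> D_term r k p \<nu> = normalized r k p \<nu> * weight k 1 p \<nu>"
  using prime_gt_0_nat[of p]
  by (simp add: D_term_def normalized_def spread_def weight_altdef powr_minus divide_simps
       flip: powr_add) (simp add: algebra_simps)

lemma normalized_zero: "k > 0 \<Longrightarrow> p > 0 \<Longrightarrow> normalized r k p (\<lambda>i\<in>{..<k}. 0) = 1"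
  by (auto simp: normalized_def spread_def weight_def tuple_max_def tuple_min_def
        image_constant_conv lessThan_empty_iff)

text \<open>A second coordinate, available since k \<ge> 2, makes the minimum 0, while the maximum
  and the sum are both 1; so p^r and p^(-r) cancel.\<close>

lemma normalized_unit:
  assumes "k \<ge> 2" "j < k" "p > 0"
  shows "normalized r k p (\<lambda>i\<in>{..<k}. of_bool (i = j)) = 1"
proof -
  let ?e = "\<lambda>i\<in>{..<k}. of_bool (i = j) :: nat"
  have sum: "(\<Sum>i<k. ?e i) = 1"
    using assms by (simp add: of_bool_def)
  have "tuple_max k ?e = 1"
    unfolding tuple_max_def using assms by (intro Max_eqI) auto
  moreover have "\<exists>i<k. i \<noteq> j"
    using assms by (intro exI[of _ "if j = 0 then 1 else 0"]) auto
  hence "tuple_min k ?e = 0"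
    unfolding tuple_min_def by (intro Min_eqI) (auto simp: image_iff)
  ultimately show ?thesis
    unfolding normalized_def spread_def weight_def sum using assms
    by (simp flip: powr_add)
qed

text \<open>The local values of h in the decomposition of g over divisor tuples.\<close>

definition mobius_local :: "real \<Rightarrow> nat \<Rightarrow> nat \<Rightarrow> (nat \<Rightarrow> nat) \<Rightarrow> real" where
  "mobius_local r k p = mixed_diff k (normalized r k p)"

text \<open>In degree 1 the mixed difference is the value of \<open>normalized\<close> at a unit
  tuple minus its value at the zero tuple, that is 1 - 1 = 0. The first degree that can contribute
  after 0 is therefore 2, and the convergence condition becomes 2 \<sigma> > 1.\<close>

lemma local_factors_mobius:
  assumes k: "k \<ge> 2" and r: "r > 0" and \<sigma>: "\<sigma> > 1 / 2"
  shows "local_factors k 2 (\<lambda>p \<nu>. mobius_local r k p \<nu> * weight k \<sigma> p \<nu>) (2 ^ k) \<sigma>"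
proof
  fix p :: nat assume p: "prime p"
  hence p0: "p > 0" by (simp add: prime_gt_0_nat)
  have "mobius_local r k p (\<lambda>i\<in>{..<k}. 0) = 1"
    unfolding mobius_local_def using k p0
    by (subst mixed_diff_zero) (auto simp: tuples_def normalized_zero)
  thus "mobius_local r k p (\<lambda>i\<in>{..<k}. 0) * weight k \<sigma> p (\<lambda>i\<in>{..<k}. 0) = 1"
    by (simp add: weight_def)
  fix \<nu> assume \<nu>: "\<nu> \<in> tuples k UNIV"
  have "\<bar>mobius_local r k p \<nu>\<bar> \<le> 2 ^ k"
    unfolding mobius_local_def using k r p by (intro abs_mixed_diff_le abs_normalized_le_1) auto
  thus "\<bar>mobius_local r k p \<nu> * weight k \<sigma> p \<nu>\<bar> \<le> 2 ^ k * (real p powr (-\<sigma>)) ^ (\<Sum>i<k. \<nu> i)"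
    by (auto simp: abs_mult weight_def intro!: mult_right_mono)
  assume "0 < (\<Sum>i<k. \<nu> i)" "(\<Sum>i<k. \<nu> i) < 2"
  hence "(\<Sum>i<k. \<nu> i) = 1" by linarith
  then obtain j where j: "j < k" "\<nu> j = 1" "\<And>i. i < k \<Longrightarrow> i \<noteq> j \<Longrightarrow> \<nu> i = 0"
    by (subst (asm) sum_eq_1_iff) auto
  have "\<nu> = (\<lambda>i\<in>{..<k}. of_bool (i = j))"
    using \<nu> j by (auto simp: tuples_def fun_eq_iff PiE_iff extensional_def)
  hence "mobius_local r k p \<nu> = 0"
    using mixed_diff_unit[OF j(1)] normalized_unit[OF k j(1) p0] normalized_zero[of k p] k p0
    by (simp add: mobius_local_def)
  thus "mobius_local r k p \<nu> * weight k \<sigma> p \<nu> = 0" by simp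
qed (use \<sigma> in auto)

section \<open>The local series of C and D and their relation\<close>

lemma D_term_summable:
  assumes "k > 0" "r > 0" "prime p"
  shows "D_term r k p summable_on tuples k UNIV"
proof (rule summable_on_comparison_test)
  have "real p powr (-1) < 1"
    using prime_gt_1_nat[OF assms(3)] by (intro powr_less_one) auto
  thus "weight k 1 p summable_on tuples k UNIV"
    unfolding weight_def by (intro summable_on_geometric_tuples) auto
  show "D_term r k p \<nu> \<le> weight k 1 p \<nu>" for \<nu>
    using normalized_le_1[OF assms, of \<nu>]
    by (simp add: D_term_eq[OF assms(3)] weight_def mult_left_le_one_le normalized_nonneg)
  show "0 \<le> D_term r k p \<nu>" for \<nu>
    by (simp add: D_term_def)
qed

lemma C_term_summable:
  assumes "k > 0" "r > 0" "prime p"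
  shows "C_term r k p summable_on tuples k UNIV"
proof (rule summable_on_comparison_test)
  have p: "real p > 1" using prime_gt_1_nat[OF assms(3)] by simp
  have "real p powr (-1) < 1"
    using p by (intro powr_less_one) auto
  thus "weight k 1 p summable_on tuples k UNIV"
    unfolding weight_def by (intro summable_on_geometric_tuples) auto
  show "0 \<le> C_term r k p \<nu>" for \<nu>
    by (simp add: C_term_def)
  show "C_term r k p \<nu> \<le> weight k 1 p \<nu>" for \<nu>
  proof -
    have "C_term r k p \<nu> = real p powr (r * real (tuple_max k \<nu>) - (r + 1) * real (\<Sum>i<k. \<nu> i))"
      by (simp only: C_term_def powr_diff)
    also have "\<dots> \<le> real p powr (- (1 * real (\<Sum>i<k. \<nu> i)))"
    proof (intro powr_mono)
      have "r * real (tuple_max k \<nu>) \<le> r * real (\<Sum>i<k. \<nu> i)"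
        using assms by (intro mult_left_mono of_nat_mono tuple_max_le_sum) auto
      thus "r * real (tuple_max k \<nu>) - (r + 1) * real (\<Sum>i<k. \<nu> i) \<le> - (1 * real (\<Sum>i<k. \<nu> i))"
        by (simp add: distrib_right)
    qed (use p in auto)
    also have "\<dots> = weight k 1 p \<nu>"
      using p by (subst weight_altdef) auto
    finally show ?thesis .
  qed
qed

text \<open>
  Splitting off the minimum: every tuple is a diagonal shift of a tuple with minimum \<open>0\<close>, and on the
  latter the summands of \<open>C\<close> and \<open>D\<close> agree.
\<close>

lemma infsum_diagonal_shift:
  fixes f :: "(nat \<Rightarrow> nat) \<Rightarrow> real"
  assumes k: "k > 0" and f: "f summable_on tuples k UNIV"
    and shift: "\<And>\<nu>. \<nu> \<in> tuples k UNIV \<Longrightarrow> f (\<lambda>i\<in>{..<k}. Suc (\<nu> i)) = q * f \<nu>"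
  shows "(1 - q) * infsum f (tuples k UNIV) = infsum f {\<nu> \<in> tuples k UNIV. tuple_min k \<nu> = 0}"
proof -
  let ?T = "tuples k UNIV :: (nat \<Rightarrow> nat) set"
  let ?Z = "{\<nu> \<in> ?T. tuple_min k \<nu> = 0}"
  let ?s = "\<lambda>\<nu>. \<lambda>i\<in>{..<k}. Suc (\<nu> i)"
  have min: "tuple_min k \<nu> = 0 \<longleftrightarrow> (\<exists>i<k. \<nu> i = 0)" for \<nu>
  proof -
    have "tuple_min k \<nu> \<in> \<nu> ` {..<k}"
      unfolding tuple_min_def using k by (intro Min_in) auto
    moreover have "tuple_min k \<nu> \<le> \<nu> i" if "i < k" for i
      unfolding tuple_min_def using that by (intro Min_le) auto
    ultimately show ?thesis by force
  qed
  \<comment> \<open>A tuple has positive minimum exactly when it is a shift by (1, ..., 1), so the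
    tuples outside \<open>?Z\<close> carry q times the whole sum.\<close>
  have bij: "bij_betw ?s ?T (?T - ?Z)"
  proof (rule bij_betw_byWitness[where f' = "\<lambda>\<nu>. \<lambda>i\<in>{..<k}. \<nu> i - 1"])
    show "\<forall>\<nu>\<in>?T. (\<lambda>i\<in>{..<k}. ?s \<nu> i - 1) = \<nu>"
      by (auto simp: tuples_def fun_eq_iff PiE_iff extensional_def)
    show "\<forall>\<nu>\<in>?T - ?Z. ?s (\<lambda>i\<in>{..<k}. \<nu> i - 1) = \<nu>"
      by (auto simp: min tuples_def fun_eq_iff PiE_iff extensional_def)
    show "?s ` ?T \<subseteq> ?T - ?Z"
    proof (intro image_subsetI)
      fix \<nu> show "?s \<nu> \<in> ?T - ?Z" by (simp add: min) (simp add: tuples_def)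
    qed
    show "(\<lambda>\<nu>. \<lambda>i\<in>{..<k}. \<nu> i - 1) ` (?T - ?Z) \<subseteq> ?T"
      by (auto simp: tuples_def)
  qed
  have "infsum f (?T - ?Z) = (\<Sum>\<^sub>\<infinity>\<nu>\<in>?T. f (?s \<nu>))"
    by (rule infsum_reindex_bij_betw[OF bij, symmetric])
  also have "\<dots> = (\<Sum>\<^sub>\<infinity>\<nu>\<in>?T. q * f \<nu>)"
    by (intro infsum_cong shift)
  also have "\<dots> = q * infsum f ?T"
    by (rule infsum_cmult_right')
  finally have "infsum f (?T - ?Z) = q * infsum f ?T" .
  moreover have "infsum f (?T - ?Z) = infsum f ?T - infsum f ?Z"
    by (intro infsum_Diff f summable_on_subset_banach[OF f]) auto
  ultimately show ?thesis by (simp add: algebra_simps)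
qed

lemma tuple_max_min_shift:
  assumes "k > 0"
  shows "tuple_max k (\<lambda>i\<in>{..<k}. Suc (\<nu> i)) = Suc (tuple_max k \<nu>)"
    and "tuple_min k (\<lambda>i\<in>{..<k}. Suc (\<nu> i)) = Suc (tuple_min k \<nu>)"
proof -
  have *: "(\<lambda>i\<in>{..<k}. Suc (\<nu> i)) ` {..<k} = Suc ` \<nu> ` {..<k}"
    by (auto simp: image_iff)
  show "tuple_max k (\<lambda>i\<in>{..<k}. Suc (\<nu> i)) = Suc (tuple_max k \<nu>)"
    unfolding tuple_max_def * using assms by (subst mono_Max_commute) (auto simp: mono_def)
  show "tuple_min k (\<lambda>i\<in>{..<k}. Suc (\<nu> i)) = Suc (tuple_min k \<nu>)"
    unfolding tuple_min_def * using assms by (subst mono_Min_commute) (auto simp: mono_def)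
qed

text \<open>A diagonal shift raises the degree by k and the maximum by 1, but leaves the difference
  of maximum and minimum fixed. The shift ratios are therefore p^(-(r+1)k) for D and p^(-(r+1)k + r)
  for C, and both sides equal the common sum over tuples with minimum 0.\<close>

lemma infsum_C_term_D_term:
  assumes k: "k > 0" and r: "r > 0" and p: "prime p"
  shows "(1 - real p powr (-((r + 1) * real k))) * infsum (D_term r k p) (tuples k UNIV) =
         (1 - real p powr (-((r + 1) * real k - r))) * infsum (C_term r k p) (tuples k UNIV)"
proof -
  let ?Z = "{\<nu> \<in> tuples k UNIV. tuple_min k \<nu> = 0}"
  have p0: "real p > 0" using p by (simp add: prime_gt_0_nat)
  have sum: "(\<Sum>i<k. (\<lambda>i\<in>{..<k}. Suc (\<nu> i)) i) = (\<Sum>i<k. \<nu> i) + k" for \<nu>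
    by (simp add: sum_Suc)
  have D: "(1 - real p powr (-((r + 1) * real k))) * infsum (D_term r k p) (tuples k UNIV) =
      infsum (D_term r k p) ?Z"
  proof (rule infsum_diagonal_shift[OF k D_term_summable[OF k r p]])
    fix \<nu>
    show "D_term r k p (\<lambda>i\<in>{..<k}. Suc (\<nu> i)) = real p powr (-((r + 1) * real k)) * D_term r k p \<nu>"
      using p0 unfolding D_term_def tuple_max_min_shift[OF k] sum
      by (simp add: algebra_simps powr_add powr_diff powr_minus divide_simps)
  qed
  have C: "(1 - real p powr (-((r + 1) * real k - r))) * infsum (C_term r k p) (tuples k UNIV) =
      infsum (C_term r k p) ?Z"
  proof (rule infsum_diagonal_shift[OF k C_term_summable[OF k r p]])
    fix \<nu>
    show "C_term r k p (\<lambda>i\<in>{..<k}. Suc (\<nu> i)) = real p powr (-((r + 1) * real k - r)) * C_term r k p \<nu>"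
      using p0 unfolding C_term_def tuple_max_min_shift[OF k] sum
      by (simp add: algebra_simps powr_add powr_diff powr_minus divide_simps)
  qed
  have "infsum (D_term r k p) ?Z = infsum (C_term r k p) ?Z"
    by (intro infsum_cong) (auto simp: C_term_def D_term_def)
  thus ?thesis using C D by simp
qed

text \<open>At \<sigma> = 1, summation by parts with q = 1/p identifies the local sum of h with the
  Euler factor of \<open>D_term\<close>. Convergence and the value then come from the Euler product
  of h.\<close>

lemma
  assumes "k \<ge> 2" "r > 0"
  shows convergent_prod_D: "convergent_prod (euler_factor k (D_term r k))"
    and D_const_eq_infsum: "D_const r k = (\<Sum>\<^sub>\<infinity>d\<in>tuples k {0<..}. mult_fun k (mobius_local r k) d * (\<Prod>i<k. real (d i) powr (-1)))"
proof -
  interpret local_factors k 2 "\<lambda>p \<nu>. mobius_local r k p \<nu> * weight k 1 p \<nu>" "2 ^ k" 1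
    by (rule local_factors_mobius) (use assms in auto)
  have "euler p = euler_factor k (D_term r k) p" for p
  proof (cases "prime p")
    case True
    hence p: "real p > 1" using prime_gt_1_nat by simp
    have "euler p = (1 - real p powr (-1)) ^ k *
        (\<Sum>\<^sub>\<infinity>\<nu>\<in>tuples k UNIV. normalized r k p \<nu> * (real p powr (-1)) ^ (\<Sum>i<k. \<nu> i))"
      unfolding euler_def if_P[OF True] unfolding weight_def mobius_local_def using p assms
      by (intro infsum_mixed_diff_geometric abs_normalized_le_1 True powr_less_one) auto
    also have "(\<lambda>\<nu>. normalized r k p \<nu> * (real p powr (-1)) ^ (\<Sum>i<k. \<nu> i)) = D_term r k p"
      by (simp add: D_term_eq[OF True] weight_def fun_eq_iff)
    also have "real p powr (-1) = 1 / real p"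
      using p by (simp add: powr_minus_divide)
    finally show ?thesis
      using True by (simp only: euler_factor_def if_True)
  qed (simp add: euler_def euler_factor_def)
  hence euler: "euler = euler_factor k (D_term r k)" by blast
  show "convergent_prod (euler_factor k (D_term r k))"
    using convergent_prod_euler unfolding euler .
  show "D_const r k = (\<Sum>\<^sub>\<infinity>d\<in>tuples k {0<..}. mult_fun k (mobius_local r k) d * (\<Prod>i<k. real (d i) powr (-1)))"
    unfolding D_const_def euler[symmetric] euler_product[symmetric]
    by (intro infsum_cong) (simp add: mult_fun_mult mult_fun_weight)
qed

text \<open>The Euler factor of C is that of D times (1 - p^(-a)) / (1 - p^(-b)), the local factor
  of zeta(b) / zeta(a). Multiplying the convergent products gives the convergence for C along with
  its value.\<close>

lemma D_const_eq_C_const: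
  assumes k: "k \<ge> 2" and r: "r > 0"
  shows "euler_converges k (C_term r k)"
    and "D_const r k = C_const r k * (zeta ((r + 1) * real k) / zeta ((r + 1) * real k - r))"
proof -
  define a b where "a = (r + 1) * real k" and "b = (r + 1) * real k - r"
  \<comment> \<open>Rearranged, this inequality says b \<ge> 2.\<close>
  have "1 * 2 + r * 1 \<le> 1 * real k + r * real k"
    using k r by (intro add_mono mult_left_mono) auto
  hence ab: "a > 1" "b > 1"
    using r by (auto simp: a_def b_def algebra_simps)
  let ?z = "\<lambda>s p. if prime p then 1 / (1 - real p powr (-s)) else 1"
  have z: "?z s p > 0" if "s > 1" for s p
    using that prime_gt_1_nat[of p] by (auto simp: powr_less_one)
  have z': "0 \<notin> range (?z s)" if "s > 1" for s
  proof
    assume "0 \<in> range (?z s)"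
    then obtain p where "0 = ?z s p" by (rule rangeE)
    thus False using z[OF that, of p] by linarith
  qed
  \<comment> \<open>A convergent infinite product vanishes only if one of its factors does.\<close>
  have zeta_nz: "zeta s \<noteq> 0" if "s > 1" for s
  proof
    assume "zeta s = 0"
    hence "0 \<in> range (?z s)"
      by (rule has_prod_eq_0_iff[OF zeta_has_prod[OF that], THEN iffD1])
    thus False using z'[OF that] by contradiction
  qed
  have D: "euler_factor k (D_term r k) has_prod D_const r k"
    unfolding D_const_def using k r by (intro convergent_prod_has_prod convergent_prod_D)
  have "(\<lambda>p. euler_factor k (D_term r k) p * (?z b p * inverse (?z a p))) has_prod
           (D_const r k * (zeta b * inverse (zeta a)))"
    by (intro has_prod_mult D has_prod_inverse zeta_has_prod ab)
  also have "(\<lambda>p. euler_factor k (D_term r k) p * (?z b p * inverse (?z a p))) =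
             euler_factor k (C_term r k)"
  proof
    fix p
    show "euler_factor k (D_term r k) p * (?z b p * inverse (?z a p)) = euler_factor k (C_term r k) p"
    proof (cases "prime p")
      case True
      have "1 - real p powr (-b) \<noteq> 0" "1 - real p powr (-a) \<noteq> 0"
        using z[OF ab(1), of p] z[OF ab(2), of p] True by auto
      moreover have "(1 - real p powr (-a)) * infsum (D_term r k p) (tuples k UNIV) =
          (1 - real p powr (-b)) * infsum (C_term r k p) (tuples k UNIV)"
        unfolding a_def b_def using infsum_C_term_D_term[of k r p] k r True by simp
      ultimately have "infsum (C_term r k p) (tuples k UNIV) = infsum (D_term r k p) (tuples k UNIV) *
          (1 / (1 - real p powr (-b)) * inverse (1 / (1 - real p powr (-a))))"
        by (simp add: divide_simps mult_ac)
      thus ?thesis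
        using True by (simp add: euler_factor_def mult_ac)
    qed (simp add: euler_factor_def)
  qed
  finally have C: "euler_factor k (C_term r k) has_prod (D_const r k * (zeta b * inverse (zeta a)))" .
  thus "euler_converges k (C_term r k)"
    using C_term_summable[of k r] k r by (auto simp: euler_converges_def has_prod_iff)
  have "C_const r k = D_const r k * (zeta b * inverse (zeta a))"
    using C by (simp add: C_const_def has_prod_iff)
  thus "D_const r k = C_const r k * (zeta ((r + 1) * real k) / zeta ((r + 1) * real k - r))"
    using zeta_nz[OF ab(1)] zeta_nz[OF ab(2)] unfolding a_def b_def by (simp add: field_simps)
qed

subsection \<open>Counting\<close>

definition power_sum :: "real \<Rightarrow> real \<Rightarrow> real" where
  "power_sum r y = (\<Sum>m | 0 < m \<and> real m \<le> y. real m powr r)"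

lemma finite_pos_le [simp, intro]: "finite {m. 0 < m \<and> real m \<le> y}"
  by (rule finite_subset[of _ "{..nat \<lfloor>y\<rfloor>}"]) (auto simp: le_nat_floor)

text \<open>The mean value theorem for an antiderivative of x^r, with x^r increasing.\<close>

lemma powr_increment_bounds:
  fixes a b r :: real
  assumes "0 \<le> a" "a \<le> b" "r > 0"
  shows "(b - a) * a powr r \<le> b powr (r + 1) / (r + 1) - a powr (r + 1) / (r + 1)"
    and "b powr (r + 1) / (r + 1) - a powr (r + 1) / (r + 1) \<le> (b - a) * b powr r"
proof -
  let ?f = "\<lambda>x. x powr (r + 1) / (r + 1)"
  have "(b - a) * a powr r \<le> ?f b - ?f a \<and> ?f b - ?f a \<le> (b - a) * b powr r"
  proof (cases "a = b")
    case False
    hence "a < b" using assms by simp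
    \<comment> \<open>The derivative is needed only in the open interval; if a = 0, continuity at
      the left end suffices.\<close>
    have deriv: "(?f has_real_derivative x powr r) (at x)" if "x > 0" for x
      using that assms by (auto intro!: derivative_eq_intros)
    have cont: "continuous_on {a..b} ?f"
      using assms by (intro continuous_intros continuous_on_powr') auto
    have diff: "?f differentiable (at x)" if "a < x" "x < b" for x
      unfolding real_differentiable_def using that assms by (intro exI[of _ "x powr r"] deriv) auto
    obtain l z where z: "a < z" "z < b" "(?f has_real_derivative l) (at z)" "?f b - ?f a = (b - a) * l"
      using MVT[OF \<open>a < b\<close> cont diff] by blast
    have "l = z powr r"
      using DERIV_unique[OF z(3) deriv] z assms by simp
    moreover have "a powr r \<le> z powr r" "z powr r \<le> b powr r"
      using z assms by (auto intro!: powr_mono2)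
    ultimately show ?thesis
      using z(4) \<open>a < b\<close> by (auto intro!: mult_left_mono)
  qed auto
  thus "(b - a) * a powr r \<le> ?f b - ?f a" "?f b - ?f a \<le> (b - a) * b powr r" by auto
qed

text \<open>Comparison with the integral of x^r over unit intervals, followed by a last interval
  from N to y of length at most 1.\<close>

lemma power_sum_bounds:
  assumes y: "y > 0" and r: "r > 0"
  shows "0 \<le> power_sum r y" "power_sum r y \<le> y powr (r + 1)"
    and "\<bar>power_sum r y - y powr (r + 1) / (r + 1)\<bar> \<le> y powr r"
proof -
  define N where "N = nat \<lfloor>y\<rfloor>"
  have N: "real N \<le> y" "y - real N \<le> 1"
    using y by (auto simp: N_def) linarith
  define T where "T = (\<lambda>x::real. x powr (r + 1) / (r + 1))"
  have set: "{m. 0 < m \<and> real m \<le> y} = {1..N}"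
    using y by (auto simp: N_def le_nat_floor) linarith+
  have S: "power_sum r y = (\<Sum>m=1..N. real m powr r)"
    by (simp add: power_sum_def set)
  show nonneg: "0 \<le> power_sum r y"
    by (simp add: S sum_nonneg)
  have "power_sum r y \<le> (\<Sum>m=1..N. y powr r)"
    unfolding S using N r by (intro sum_mono powr_mono2) auto
  also have "\<dots> = real N * y powr r" by simp
  also have "\<dots> \<le> y * y powr r" using N by (intro mult_right_mono) auto
  finally show "power_sum r y \<le> y powr (r + 1)"
    using y by (simp add: powr_add mult_ac)
  have inc: "real m powr r \<le> T (real (Suc m)) - T (real m)"
    "T (real (Suc m)) - T (real m) \<le> real (Suc m) powr r" for m
    using powr_increment_bounds[of "real m" "real (Suc m)" r] r by (auto simp: T_def)
  \<comment> \<open>The upper bounds on the increments sum to the first inequality. The lower bounds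
    concern the left endpoint of each interval, which leaves the last summand
    \<open>real n powr r\<close> over in the second.\<close>
  have "T (real n) \<le> (\<Sum>m=1..n. real m powr r) \<and>
        (\<Sum>m=1..n. real m powr r) \<le> T (real n) + real n powr r" for n
  proof (induction n)
    case (Suc n)
    thus ?case using inc[of n] by simp
  qed (simp add: T_def)
  hence "T N \<le> power_sum r y" "power_sum r y \<le> T N + N powr r"
    by (auto simp: S)
  moreover have "T y - T N \<le> (y - N) * y powr r"
    using powr_increment_bounds(2)[of N y r] N r by (simp add: T_def)
  moreover have "(y - N) * y powr r \<le> 1 * y powr r"
    using N by (intro mult_right_mono) auto
  moreover have "real N powr r \<le> y powr r" "T N \<le> T y"
    using N r by (auto simp: T_def intro!: powr_mono2 divide_right_mono)
  ultimately have "\<bar>power_sum r y - T y\<bar> \<le> y powr r"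
    by (auto simp: abs_le_iff)
  thus "\<bar>power_sum r y - y powr (r + 1) / (r + 1)\<bar> \<le> y powr r"
    by (simp add: T_def)
qed

text \<open>For y \<ge> 1 this weakens the error y^r. For y < 1 the sum and the main term both lie
  between 0 and y^(r+1), which is at most y^(r+1-\<delta>). Uniformity down to 0 matters because y
  will be x / \<open>d i\<close> with unbounded \<open>d i\<close>.\<close>

lemma power_sum_error:
  assumes y: "y > 0" and r: "r > 0" and \<delta>: "0 \<le> \<delta>" "\<delta> \<le> 1"
  shows "\<bar>power_sum r y - y powr (r + 1) / (r + 1)\<bar> \<le> y powr (r + 1 - \<delta>)"
proof (cases "y \<ge> 1")
  case True
  have "y powr r \<le> y powr (r + 1 - \<delta>)"
    using True \<delta> by (intro powr_mono) auto
  thus ?thesis using power_sum_bounds(3)[OF y r] by linarith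
next
  case False
  have "y powr (r + 1) / (r + 1) \<le> y powr (r + 1)"
    using r by (simp add: divide_le_eq mult_le_cancel_left1)
  moreover have "0 \<le> y powr (r + 1) / (r + 1)" using r by simp
  ultimately have "\<bar>power_sum r y - y powr (r + 1) / (r + 1)\<bar> \<le> y powr (r + 1)"
    using power_sum_bounds(1,2)[OF y r] by linarith
  also have "\<dots> \<le> y powr (r + 1 - \<delta>)"
    using False y \<delta> by (intro powr_mono') auto
  finally show ?thesis .
qed

section \<open>Exact expansion of the sum over divisor tuples\<close>

lemma sum_multiples_powr:
  assumes "d > 0"
  shows "(\<Sum>m | 0 < m \<and> real m \<le> x. if d dvd m then real m powr r else 0) =
         real d powr r * power_sum r (x / real d)"
proof -
  have "(\<Sum>m | 0 < m \<and> real m \<le> x. if d dvd m then real m powr r else 0) =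
        (\<Sum>m\<in>{m. 0 < m \<and> real m \<le> x} \<inter> {m. d dvd m}. real m powr r)"
    by (simp add: sum.inter_restrict)
  also have "\<dots> = (\<Sum>j | 0 < j \<and> real j \<le> x / real d. real (d * j) powr r)"
    using assms
    by (intro sum.reindex_bij_witness[of _ "\<lambda>j. d * j" "\<lambda>m. m div d"])
       (auto simp: field_simps elim!: dvdE)
  also have "\<dots> = real d powr r * power_sum r (x / real d)"
    by (simp add: power_sum_def sum_distrib_left powr_mult)
  finally show ?thesis .
qed

lemma prod_if_zero:
  "finite I \<Longrightarrow> (\<Prod>i\<in>I. if P i then f i else 0) = (if \<forall>i\<in>I. P i then \<Prod>i\<in>I. f i else 0)"
  for f :: "'a \<Rightarrow> 'b :: comm_semiring_1"
  by (induction I rule: finite_induct) auto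

definition mobius_transform :: "real \<Rightarrow> nat \<Rightarrow> (nat \<Rightarrow> nat) \<Rightarrow> real" where
  "mobius_transform r k = mult_fun k (mobius_local r k)"

text \<open>At each prime, \<open>sum_mixed_diff\<close> inverts the mixed difference, so the
  divisor sum of h is g; the r-th powers of the entries then undo the normalization.\<close>

lemma lcm_gcd_powr_eq_sum:
  assumes n: "n \<in> tuples k {0<..}" and k: "k > 0" and r: "r > 0"
  shows "(real (Lcm (n ` {..<k})) / real (Gcd (n ` {..<k}))) powr r =
         (\<Sum>d\<in>PiE {..<k} (\<lambda>i. {d. d dvd n i}). mobius_transform r k d) * (\<Prod>i<k. real (n i) powr r)"
proof -
  have "mobius_local r k p (\<lambda>i\<in>{..<k}. 0) = 1" if "prime p" for p
    unfolding mobius_local_def using k prime_gt_0_nat[OF that]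
    by (subst mixed_diff_zero) (auto simp: tuples_def normalized_zero)
  hence "(\<Sum>d\<in>PiE {..<k} (\<lambda>i. {d. d dvd n i}). mobius_transform r k d) =
        mult_fun k (\<lambda>p \<nu>. \<Sum>\<mu>\<in>PiE {..<k} (\<lambda>i. {..\<nu> i}). mobius_local r k p \<mu>) n"
    unfolding mobius_transform_def by (intro sum_mult_fun_divisors n) auto
  also have "\<dots> = mult_fun k (\<lambda>p \<nu>. spread r k p \<nu> * weight k r p \<nu>) n"
  proof (rule mult_fun_cong)
    fix p :: nat and \<nu> assume "prime p" "\<nu> \<in> tuples k UNIV"
    thus "(\<Sum>\<mu>\<in>PiE {..<k} (\<lambda>i. {..\<nu> i}). mobius_local r k p \<mu>) = spread r k p \<nu> * weight k r p \<nu>"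
      unfolding mobius_local_def normalized_def[symmetric]
      by (intro sum_mixed_diff abs_normalized_le_1 k r)
  qed
  also have "\<dots> = (real (Lcm (n ` {..<k})) / real (Gcd (n ` {..<k}))) powr r * (\<Prod>i<k. real (n i) powr (-r))"
    using mult_fun_spread[OF n k] mult_fun_weight[OF n] by (simp add: mult_fun_mult)
  finally have *: "(\<Sum>d\<in>PiE {..<k} (\<lambda>i. {d. d dvd n i}). mobius_transform r k d) = \<dots>" .
  have "(\<Prod>i<k. real (n i) powr (-r)) * (\<Prod>i<k. real (n i) powr r) = (\<Prod>i<k. 1)"
    unfolding prod.distrib[symmetric] using n
    by (intro prod.cong refl) (auto simp: tuples_def PiE_iff simp flip: powr_add)
  thus ?thesis unfolding * by (simp add: mult.assoc)
qed

text \<open>Insert the divisor sum and exchange the summations. The result is phrased as a series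
  over all positive tuples so that the series of \<open>D_const\<close> can be subtracted from it
  term by term.\<close>

lemma lcm_gcd_sum_has_sum:
  assumes k: "k > 0" and r: "r > 0"
  shows "((\<lambda>d. mobius_transform r k d * (\<Prod>i<k. real (d i) powr r * power_sum r (x / real (d i))))
           has_sum lcm_gcd_sum r k x) (tuples k {0<..})"
proof -
  let ?A = "{m. 0 < m \<and> real m \<le> x}"
  let ?T = "tuples k ?A"
  let ?h = "mobius_transform r k"
  have fin: "finite ?T" unfolding tuples_def by (intro finite_PiE) auto
  have sub: "?T \<subseteq> tuples k {0<..}" unfolding tuples_def by (intro PiE_mono) auto
  have "lcm_gcd_sum r k x = (\<Sum>n\<in>?T. \<Sum>d\<in>?T. ?h d * (\<Prod>i<k. if d i dvd n i then real (n i) powr r else 0))"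
    unfolding lcm_gcd_sum_def
  proof (intro sum.cong refl)
    fix n assume n: "n \<in> ?T"
    \<comment> \<open>Divisor tuples of n stay in \<open>?T\<close>, so divisibility becomes an
      indicator in a sum over a set independent of n, and the sums can be exchanged.\<close>
    have div: "PiE {..<k} (\<lambda>i. {d. d dvd n i}) = ?T \<inter> {d. \<forall>i<k. d i dvd n i}"
    proof (intro equalityI subsetI)
      fix d assume d: "d \<in> PiE {..<k} (\<lambda>i. {d. d dvd n i})"
      have "0 < d i \<and> real (d i) \<le> x" if "i < k" for i
      proof -
        have "d i dvd n i" "0 < n i" "real (n i) \<le> x"
          using d n that by (auto simp: tuples_def PiE_iff)
        thus ?thesis using dvd_imp_le[of "d i" "n i"] dvd_pos_nat[of "n i" "d i"] by auto
      qed
      thus "d \<in> ?T \<inter> {d. \<forall>i<k. d i dvd n i}"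
        using d by (auto simp: tuples_def PiE_iff)
    qed (auto simp: tuples_def PiE_iff)
    have "(real (Lcm (n ` {..<k})) / real (Gcd (n ` {..<k}))) powr r =
        (\<Sum>d\<in>?T \<inter> {d. \<forall>i<k. d i dvd n i}. ?h d) * (\<Prod>i<k. real (n i) powr r)"
      using lcm_gcd_powr_eq_sum[of n k r] n sub k r div by auto
    also have "\<dots> = (\<Sum>d\<in>?T. ?h d * (\<Prod>i<k. if d i dvd n i then real (n i) powr r else 0))"
      using fin by (simp add: sum.inter_restrict sum_distrib_right prod_if_zero)
        (intro sum.cong, auto)
    finally show "(real (Lcm (n ` {..<k})) / real (Gcd (n ` {..<k}))) powr r = \<dots>" .
  qed
  also have "\<dots> = (\<Sum>d\<in>?T. \<Sum>n\<in>?T. ?h d * (\<Prod>i<k. if d i dvd n i then real (n i) powr r else 0))"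
    by (rule sum.swap)
  also have "\<dots> = (\<Sum>d\<in>?T. ?h d * (\<Prod>i<k. real (d i) powr r * power_sum r (x / real (d i))))"
  proof (intro sum.cong refl)
    fix d assume d: "d \<in> ?T"
    have "(\<Sum>n\<in>?T. ?h d * (\<Prod>i<k. if d i dvd n i then real (n i) powr r else 0)) =
        ?h d * (\<Prod>i<k. \<Sum>m\<in>?A. if d i dvd m then real m powr r else 0)"
      unfolding tuples_def sum_distrib_left[symmetric] by (subst prod_sum_PiE) auto
    also have "(\<Prod>i<k. \<Sum>m\<in>?A. if d i dvd m then real m powr r else 0) =
        (\<Prod>i<k. real (d i) powr r * power_sum r (x / real (d i)))"
      using d by (intro prod.cong sum_multiples_powr) (auto simp: tuples_def PiE_iff)
    finally show "(\<Sum>n\<in>?T. ?h d * (\<Prod>i<k. if d i dvd n i then real (n i) powr r else 0)) =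
      ?h d * (\<Prod>i<k. real (d i) powr r * power_sum r (x / real (d i)))" .
  qed
  finally have sum: "lcm_gcd_sum r k x = \<dots>" .
  show ?thesis
  proof (rule has_sum_finite_neutralI[OF fin sub _ sum])
    \<comment> \<open>Outside \<open>?T\<close> some \<open>d i\<close> exceeds x, and the power sum
      at x / \<open>d i\<close> is empty.\<close>
    fix d assume d: "d \<in> tuples k {0<..} - ?T"
    then obtain i where i: "i < k" "real (d i) > x" "d i > 0"
      by (force simp: tuples_def PiE_iff)
    hence "x / real (d i) < 1" by simp
    hence "{m. 0 < m \<and> real m \<le> x / real (d i)} = {}" by auto
    hence "power_sum r (x / real (d i)) = 0"
      by (simp only: power_sum_def sum.empty)
    thus "?h d * (\<Prod>i<k. real (d i) powr r * power_sum r (x / real (d i))) = 0"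
      using i by (auto intro!: prod_zero)
  qed
qed

section \<open>The error term\<close>

lemma prod_power_sum_error:
  fixes d :: "nat \<Rightarrow> nat"
  assumes x: "x > 0" and r: "r > 0" and \<delta>: "0 \<le> \<delta>" "\<delta> \<le> 1" and d: "\<And>i. i < k \<Longrightarrow> d i > 0"
  shows "\<bar>(\<Prod>i<k. real (d i) powr r * power_sum r (x / real (d i)))
           - (\<Prod>i<k. x powr (r + 1) / (r + 1) * real (d i) powr (-1))\<bar>
         \<le> real k * x powr (real k * (r + 1) - \<delta>) * (\<Prod>i<k. real (d i) powr (-(1 - \<delta>)))"
proof -
  define A where "A = (\<lambda>i. real (d i) powr r * power_sum r (x / real (d i)))"
  define B where "B = (\<lambda>i. x powr (r + 1) / (r + 1) * real (d i) powr (-1))"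
  \<comment> \<open>A common majorant of \<open>A i\<close> and \<open>B i\<close>, larger by
    \<open>d i powr \<delta>\<close> than their natural size x^(r+1) / \<open>d i\<close>. This loss
    in \<open>d i\<close> pays for the saving x^(-\<delta>) in the difference.\<close>
  define c where "c = (\<lambda>i. x powr (r + 1) * real (d i) powr (-(1 - \<delta>)))"
  have c: "c i > 0" if "i < k" for i
    using x d[OF that] by (simp add: c_def)
  have bounds: "\<bar>A i\<bar> \<le> c i" "\<bar>B i\<bar> \<le> c i" "\<bar>A i - B i\<bar> \<le> c i * x powr (-\<delta>)" if "i < k" for i
  proof -
    define u where "u = x / real (d i)"
    have di: "real (d i) \<ge> 1" using d[OF that] by simp
    have u: "u > 0" using x d[OF that] by (simp add: u_def)
    have scale: "real (d i) powr r * u powr s = x powr s * real (d i) powr (r - s)" for s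
      using d[OF that] x by (simp add: u_def powr_divide powr_diff)
    have B: "B i = real (d i) powr r * (u powr (r + 1) / (r + 1))"
      using scale[of "r + 1"] by (simp add: B_def)
    have le: "x powr (r + 1) * real (d i) powr (-1) \<le> c i"
      unfolding c_def using di \<delta> by (intro mult_left_mono powr_mono) auto
    have "A i \<le> real (d i) powr r * u powr (r + 1)"
      unfolding A_def u_def[symmetric] by (intro mult_left_mono power_sum_bounds u r) auto
    moreover have "A i \<ge> 0"
      unfolding A_def u_def[symmetric] by (intro mult_nonneg_nonneg power_sum_bounds u r) auto
    ultimately show "\<bar>A i\<bar> \<le> c i" using le scale[of "r + 1"] by simp
    have "B i \<le> x powr (r + 1) * real (d i) powr (-1)"
      unfolding B_def using r by (intro mult_right_mono) (auto simp: divide_le_eq mult_le_cancel_left1)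
    moreover have "B i \<ge> 0" unfolding B_def using r by simp
    ultimately show "\<bar>B i\<bar> \<le> c i" using le by simp
    have "\<bar>A i - B i\<bar> = real (d i) powr r * \<bar>power_sum r u - u powr (r + 1) / (r + 1)\<bar>"
      unfolding A_def B u_def[symmetric] right_diff_distrib[symmetric] by (simp add: abs_mult)
    also have "\<dots> \<le> real (d i) powr r * u powr (r + 1 - \<delta>)"
      by (intro mult_left_mono power_sum_error u r \<delta>) auto
    also have "\<dots> = c i * x powr (-\<delta>)"
      unfolding scale c_def by (simp add: powr_diff powr_minus divide_inverse mult_ac)
    finally show "\<bar>A i - B i\<bar> \<le> c i * x powr (-\<delta>)" .
  qed
  have nz: "(\<Prod>i<k. c i) > 0" using c by (intro prod_pos) auto
  \<comment> \<open>After division by \<open>c i\<close> all factors have absolute value at most 1,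
    so the difference of the products telescopes into the sum of the differences.\<close>
  have "\<bar>(\<Prod>i<k. A i / c i) - (\<Prod>i<k. B i / c i)\<bar> \<le> (\<Sum>i<k. \<bar>A i / c i - B i / c i\<bar>)"
    unfolding real_norm_def[symmetric] using bounds c
    by (intro norm_prod_diff) (auto simp: abs_divide divide_le_eq order_less_imp_le)
  also have "\<dots> \<le> (\<Sum>i<k. x powr (-\<delta>))"
  proof (intro sum_mono)
    fix i assume "i \<in> {..<k}"
    hence i: "i < k" by simp
    have "\<bar>A i / c i - B i / c i\<bar> = \<bar>A i - B i\<bar> / c i"
      using c[OF i] by (simp add: abs_divide flip: diff_divide_distrib)
    also have "\<dots> \<le> x powr (-\<delta>)"
      using bounds(3)[OF i] c[OF i] by (simp add: divide_le_eq mult.commute)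
    finally show "\<bar>A i / c i - B i / c i\<bar> \<le> x powr (-\<delta>)" .
  qed
  also have "\<dots> = real k * x powr (-\<delta>)" by simp
  also have "(\<Prod>i<k. A i / c i) - (\<Prod>i<k. B i / c i) = ((\<Prod>i<k. A i) - (\<Prod>i<k. B i)) / (\<Prod>i<k. c i)"
    by (simp add: prod_dividef diff_divide_distrib)
  finally have "\<bar>(\<Prod>i<k. A i) - (\<Prod>i<k. B i)\<bar> \<le> real k * x powr (-\<delta>) * (\<Prod>i<k. c i)"
    using nz by (simp add: abs_divide divide_le_eq)
  also have "(\<Prod>i<k. c i) = x powr (real k * (r + 1)) * (\<Prod>i<k. real (d i) powr (-(1 - \<delta>)))"
    using x by (simp add: c_def prod.distrib powr_power)
  also have "real k * x powr (-\<delta>) * \<dots> =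
      real k * x powr (real k * (r + 1) - \<delta>) * (\<Prod>i<k. real (d i) powr (-(1 - \<delta>)))"
    by (simp add: powr_diff powr_minus divide_inverse mult_ac)
  finally show ?thesis by (simp add: A_def B_def)
qed

lemma mobius_transform_summable:
  assumes "k \<ge> 2" "r > 0" "\<sigma> > 1 / 2"
  shows "(\<lambda>d. mobius_transform r k d * (\<Prod>i<k. real (d i) powr (-\<sigma>))) summable_on tuples k {0<..}"
proof -
  interpret local_factors k 2 "\<lambda>p \<nu>. mobius_local r k p \<nu> * weight k \<sigma> p \<nu>" "2 ^ k" \<sigma>
    by (rule local_factors_mobius) (use assms in auto)
  show ?thesis
    using mult_fun_summable
    by (rule summable_on_cong[THEN iffD1, rotated])
       (simp add: mult_fun_mult mult_fun_weight mobius_transform_def)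
qed

text \<open>The sum and its main term are both series with coefficients h(d), so they are compared
  term by term. The bound carries the weights \<open>d i powr (-(1 - \<delta>))\<close>, and the
  weighted series of absolute values converges because 1 - \<delta> > 1/2.\<close>

lemma lcm_gcd_sum_error:
  assumes k: "k \<ge> 2" and r: "r > 0" and \<delta>: "0 \<le> \<delta>" "\<delta> < 1 / 2"
  obtains K where "\<And>x. x > 0 \<Longrightarrow>
    \<bar>lcm_gcd_sum r k x - D_const r k * (x powr (real k * (r + 1)) / (r + 1) ^ k)\<bar>
      \<le> K * x powr (real k * (r + 1) - \<delta>)"
proof
  let ?T = "tuples k {0<..} :: (nat \<Rightarrow> nat) set"
  let ?h = "mobius_transform r k"
  let ?w = "\<lambda>s d. \<Prod>i<k. real (d i) powr (-s)"
  define K where "K = (\<Sum>\<^sub>\<infinity>d\<in>?T. \<bar>?h d * ?w (1 - \<delta>) d\<bar>)"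
  have K: "((\<lambda>d. \<bar>?h d * ?w (1 - \<delta>) d\<bar>) has_sum K) ?T"
  proof -
    have "(\<lambda>d. norm (?h d * ?w (1 - \<delta>) d)) summable_on ?T"
      by (rule summable_on_iff_abs_summable_on_real[THEN iffD1, OF mobius_transform_summable])
         (use k r \<delta> in auto)
    thus ?thesis by (simp add: K_def has_sum_iff)
  qed
  fix x :: real assume x: "x > 0"
  let ?A = "\<lambda>d. \<Prod>i<k. real (d i) powr r * power_sum r (x / real (d i))"
  let ?B = "\<lambda>d. \<Prod>i<k. x powr (r + 1) / (r + 1) * real (d i) powr (-1)"
  have A: "((\<lambda>d. ?h d * ?A d) has_sum lcm_gcd_sum r k x) ?T"
    using k r by (intro lcm_gcd_sum_has_sum) auto
  have "((\<lambda>d. ?h d * ?w 1 d) has_sum D_const r k) ?T"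
    using mobius_transform_summable[of k r 1] D_const_eq_infsum[of k r] k r
    by (simp add: has_sum_iff mobius_transform_def)
  hence "((\<lambda>d. (x powr (r + 1) / (r + 1)) ^ k * (?h d * ?w 1 d)) has_sum
           ((x powr (r + 1) / (r + 1)) ^ k * D_const r k)) ?T"
    by (rule has_sum_cmult_right)
  also have "(\<lambda>d. (x powr (r + 1) / (r + 1)) ^ k * (?h d * ?w 1 d)) = (\<lambda>d. ?h d * ?B d)"
    by (simp only: prod.distrib prod_constant card_lessThan mult_ac)
  also have "(x powr (r + 1) / (r + 1)) ^ k = x powr (real k * (r + 1)) / (r + 1) ^ k"
    using x by (simp add: power_divide powr_power)
  finally have B: "((\<lambda>d. ?h d * ?B d) has_sum
      (x powr (real k * (r + 1)) / (r + 1) ^ k * D_const r k)) ?T" .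
  have "norm (lcm_gcd_sum r k x - x powr (real k * (r + 1)) / (r + 1) ^ k * D_const r k)
      \<le> (real k * x powr (real k * (r + 1) - \<delta>)) * K"
  proof (rule norm_infsum_le)
    show "((\<lambda>d. ?h d * ?A d - ?h d * ?B d) has_sum
        (lcm_gcd_sum r k x - x powr (real k * (r + 1)) / (r + 1) ^ k * D_const r k)) ?T"
      using has_sum_add[OF A has_sum_uminusI[OF B]] by simp
    show "((\<lambda>d. (real k * x powr (real k * (r + 1) - \<delta>)) * \<bar>?h d * ?w (1 - \<delta>) d\<bar>) has_sum
        (real k * x powr (real k * (r + 1) - \<delta>)) * K) ?T"
      by (rule has_sum_cmult_right[OF K])
    fix d assume d: "d \<in> ?T"
    have "norm (?h d * ?A d - ?h d * ?B d) = \<bar>?h d\<bar> * \<bar>?A d - ?B d\<bar>"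
      by (simp only: real_norm_def abs_mult right_diff_distrib[symmetric])
    also have "\<dots> \<le> \<bar>?h d\<bar> * (real k * x powr (real k * (r + 1) - \<delta>) * ?w (1 - \<delta>) d)"
      using d \<delta> by (intro mult_left_mono prod_power_sum_error x r) (auto simp: tuples_def PiE_iff)
    also have "\<dots> = (real k * x powr (real k * (r + 1) - \<delta>)) * \<bar>?h d * ?w (1 - \<delta>) d\<bar>"
      by (simp add: abs_mult abs_prod mult_ac)
    finally show "norm (?h d * ?A d - ?h d * ?B d) \<le>
      (real k * x powr (real k * (r + 1) - \<delta>)) * \<bar>?h d * ?w (1 - \<delta>) d\<bar>" .
  qed
  thus "\<bar>lcm_gcd_sum r k x - D_const r k * (x powr (real k * (r + 1)) / (r + 1) ^ k)\<bar>
      \<le> (real k * K) * x powr (real k * (r + 1) - \<delta>)"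
    by (simp add: mult_ac)
qed

theorem corollary2:
  fixes k :: nat and r :: real
  assumes "k \<ge> 3" and "r > 0"
  shows "euler_converges k (D_term r k) \<and>
    (\<forall>\<epsilon>>0. (\<lambda>x::real. lcm_gcd_sum r k x
         - D_const r k * (x powr (real k * (r + 1)) / (r + 1) ^ k))
       \<in> O[at_top](\<lambda>x. x powr (real k * (r + 1) - 1 / 2 + \<epsilon>))) \<and>
    euler_converges 3 (C_term r 3) \<and>
    D_const r 3 = C_const r 3 * (zeta (3 * r + 3) / zeta (2 * r + 3)) \<and>
    euler_converges 4 (C_term r 4) \<and>
    D_const r 4 = C_const r 4 * (zeta (4 * r + 4) / zeta (3 * r + 4))"
proof (intro conjI allI impI)
  show "euler_converges k (D_term r k)"
    using assms by (auto simp: euler_converges_def intro!: D_term_summable convergent_prod_D)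
  show "euler_converges 3 (C_term r 3)" "euler_converges 4 (C_term r 4)"
    using assms by (auto intro!: D_const_eq_C_const)
  show "D_const r 3 = C_const r 3 * (zeta (3 * r + 3) / zeta (2 * r + 3))"
    using D_const_eq_C_const(2)[of 3 r] assms by (simp add: algebra_simps)
  show "D_const r 4 = C_const r 4 * (zeta (4 * r + 4) / zeta (3 * r + 4))"
    using D_const_eq_C_const(2)[of 4 r] assms by (simp add: algebra_simps)
  fix \<epsilon> :: real assume \<epsilon>: "\<epsilon> > 0"
  \<comment> \<open>The maximum keeps \<delta> nonnegative when \<epsilon> > 1/2, and \<epsilon> > 0
    gives the strict bound \<delta> < 1/2.\<close>
  define \<delta> where "\<delta> = max 0 (1 / 2 - \<epsilon>)"
  have "0 \<le> \<delta>" "\<delta> < 1 / 2" using \<epsilon> by (auto simp: \<delta>_def max_def)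
  then obtain K where K: "\<And>x. x > 0 \<Longrightarrow>
    \<bar>lcm_gcd_sum r k x - D_const r k * (x powr (real k * (r + 1)) / (r + 1) ^ k)\<bar>
      \<le> K * x powr (real k * (r + 1) - \<delta>)"
    using lcm_gcd_sum_error[of k r \<delta>] assms by auto
  show "(\<lambda>x::real. lcm_gcd_sum r k x - D_const r k * (x powr (real k * (r + 1)) / (r + 1) ^ k))
       \<in> O[at_top](\<lambda>x. x powr (real k * (r + 1) - 1 / 2 + \<epsilon>))"
  proof (rule bigoI)
    show "eventually (\<lambda>x. norm (lcm_gcd_sum r k x - D_const r k * (x powr (real k * (r + 1)) / (r + 1) ^ k))
        \<le> \<bar>K\<bar> * norm (x powr (real k * (r + 1) - 1 / 2 + \<epsilon>))) at_top"
      using eventually_ge_at_top[of 1]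
    proof eventually_elim
      case (elim x)
      have "\<bar>lcm_gcd_sum r k x - D_const r k * (x powr (real k * (r + 1)) / (r + 1) ^ k)\<bar>
          \<le> K * x powr (real k * (r + 1) - \<delta>)"
        using elim by (intro K) auto
      \<comment> \<open>By the choice of \<delta>, -\<delta> \<le> -1/2 + \<epsilon>, and x \<ge> 1
        makes powers of x increase with the exponent.\<close>
      also have "\<dots> \<le> \<bar>K\<bar> * x powr (real k * (r + 1) - 1 / 2 + \<epsilon>)"
        using elim by (intro mult_mono powr_mono) (auto simp: \<delta>_def)
      finally show ?case by simp
    qed
  qed
qed

end
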